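(* Let $\xi_0,\xi_1,\xi_2,\ldots$ be independent and identically distributed real random variables, and for $n\ge1$ let $\mathcal{C}_n$ be the $n\times n$ random circulant matrix whose $(i,j)$ entry, for $0\le i,j\le n-1$, is $\xi_{(j-i)\bmod n}$. Suppose $\xi_0$ satisfies condition (H): there exist $M>0$ and $q\in(0,1)$ with $\sup_{u\in\mathbb{R}}\mathbb{P}(|\xi_0-u|\le1)\le 1-q$ and $\mathbb{P}(|\xi_0|>M)\le q/2$. (1) If in addition $\xi_0$ has zero mean, finite positive variance, and a moment generating function that exists on an open interval around zero, then for any $\varepsilon>0$ and $\rho\in(0,1/4)$, for all large $n$, \[ \mathbb{P}\left(\kappa(\mathcal{C}_n)\le \frac{C_0}{\varepsilon}n^{\rho+1/2}(\log n)^{1/2}\right)\ge 1-C_1\left((\varepsilon^2+\varepsilon)n^{-2\rho}+n^{-1/2+o(1)}\right), \] where $C_0,C_1>0$ depend only on the distribution of $\xi_0$. (2) If instead $\xi_0$ has zero mean and $\mathbb{E}[\xi_0^2]<\infty$, then for any $\varepsilon>0$ and $\rho\in(0,1/4)$, for all large $n$, \[ \mathbb{P}\left(\kappa(\mathcal{C}_n)\le \frac{C_0}{\varepsilon}n^{\rho+1/2}\log n\right)\ge 1-C_2\left((\varepsilon^2+\varepsilon)n^{-2\rho}+(\log n)^{-1/2}\right), \] where $C_0,C_2>0$ depend only on the distribution of $\xi_0$.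
   Context: For a square matrix $A$, $\kappa(A)=\sigma_{\max}(A)/\sigma_{\min}(A)$ is its condition number (largest over smallest singular value; taken as $+\infty$ if $A$ is singular). The notation $n^{-1/2+o(1)}$ means $n^{-1/2+\delta_n}$ for some sequence $\delta_n\to0$. *)

theory Defs
  imports "HOL-Probability.Probability"
begin

text \<open>Square n x n real matrices are represented as functions nat => nat => real,
  only the entries with indices below n being relevant; vectors of R^n as
  functions nat => real supported on {0..<n}.\<close>

definition matvec :: "nat \<Rightarrow> (nat \<Rightarrow> nat \<Rightarrow> real) \<Rightarrow> (nat \<Rightarrow> real) \<Rightarrow> (nat \<Rightarrow> real)" where
  "matvec n A x = (\<lambda>i. if i < n then (\<Sum>j<n. A i j * x j) else 0)"

definition vnorm :: "nat \<Rightarrow> (nat \<Rightarrow> real) \<Rightarrow> real" where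
  "vnorm n x = sqrt (\<Sum>i<n. (x i)\<^sup>2)"

definition unit_sphere :: "nat \<Rightarrow> (nat \<Rightarrow> real) set" where
  "unit_sphere n = {x. (\<forall>i\<ge>n. x i = 0) \<and> vnorm n x = 1}"

text \<open>Largest and smallest singular values, via their variational characterisation
  sigma_max(A) = max over unit x of |Ax|, sigma_min(A) = min over unit x of |Ax|.\<close>

definition sigma_max :: "nat \<Rightarrow> (nat \<Rightarrow> nat \<Rightarrow> real) \<Rightarrow> real" where
  "sigma_max n A = (SUP x\<in>unit_sphere n. vnorm n (matvec n A x))"

definition sigma_min :: "nat \<Rightarrow> (nat \<Rightarrow> nat \<Rightarrow> real) \<Rightarrow> real" where
  "sigma_min n A = (INF x\<in>unit_sphere n. vnorm n (matvec n A x))"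

definition cond_number :: "nat \<Rightarrow> (nat \<Rightarrow> nat \<Rightarrow> real) \<Rightarrow> ereal" where
  "cond_number n A = (if sigma_min n A = 0 then \<infinity> else ereal (sigma_max n A / sigma_min n A))"

definition circulant :: "nat \<Rightarrow> (nat \<Rightarrow> real) \<Rightarrow> (nat \<Rightarrow> nat \<Rightarrow> real)" where
  "circulant n c = (\<lambda>i j. c (nat ((int j - int i) mod int n)))"

end

theory Submission
  imports Defs "HOL-Analysis.Kronecker_Approximation_Theorem" "HOL-Real_Asymp.Real_Asymp"
begin

text \<open>
  The singular values of a circulant matrix are the moduli of its eigenvalues
  \<open>\<lambda>\<^sub>k = \<Sum>\<^sub>l \<xi>\<^sub>l exp (2\<pi>i k l / n)\<close>. Their maximum is controlled by Chernoff bounds; with only two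
  moments, the variables are truncated at \<open>\<surd>n\<close> and the remainder is estimated by Markov's inequality.

  For the minimum one uses the union bound and the small ball estimate
  \<open>P(|\<lambda>\<^sub>k| \<le> t) \<le> e\<^bsup>1/2\<^esup> E |\<phi>\<^sub>k(G / t)|\<close> with \<open>G\<close> a standard Gaussian in the plane and \<open>\<phi>\<^sub>k\<close> the
  characteristic function of \<open>\<lambda>\<^sub>k\<close>. Here \<open>-2 ln |\<phi>\<^sub>k|\<close> is at least a sum over \<open>j\<close> of the values
  \<open>\<Psi> (r cos (2\<pi>jk/n - \<theta>))\<close> of \<open>\<Psi> = 1 - |\<phi>|\<^sup>2\<close>, where \<open>\<phi>\<close> is the characteristic function of \<open>\<xi>\<^sub>0\<close>.
  Condition (H) makes \<open>\<Psi>\<close> quadratic near \<open>0\<close>, and the inequality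
  \<open>\<Psi> (a - b) \<le> 2 \<Psi> a + 2 \<Psi> b\<close> transports this to frequencies \<open>r\<close> up to order \<open>n\<^bsup>1/4\<^esup>\<close>, unless the
  order of \<open>exp (2\<pi>i k / n)\<close> is at most \<open>n\<^bsup>1/4\<^esup>\<close>. There are at most \<open>n\<^bsup>1/2\<^esup>\<close> such exceptional \<open>k\<close>, and for them the
  bound \<open>P(|\<lambda>\<^sub>k| \<le> T) = O(T\<^sup>2 / n)\<close> with \<open>T\<close> of order \<open>\<surd>(ln n)\<close> suffices; the at most two real
  eigenvalues contribute \<open>O(T / \<surd>n)\<close>.
\<close>

section \<open>Singular values of circulant matrices\<close>

definition circ_eig :: "nat \<Rightarrow> (nat \<Rightarrow> real) \<Rightarrow> nat \<Rightarrow> complex" where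
  "circ_eig n c k = (\<Sum>l<n. of_real (c l) * cis (2 * pi * real k / real n * real l))"

section \<open>Finite Fourier analysis modulo n\<close>

lemma sum_periodic_shift:
  fixes h :: "nat \<Rightarrow> 'a::ab_group_add"
  assumes "\<And>j. h (j + n) = h j"
  shows "(\<Sum>j<n. h (j + m)) = (\<Sum>j<n. h j)"
proof (induction m)
  case (Suc m)
  have "(\<Sum>j<n. h (j + Suc m)) + h m = (\<Sum>j<Suc n. h (j + m))"
    by (subst sum.lessThan_Suc_shift) (simp add: add.commute)
  also have "\<dots> = (\<Sum>j<n. h (j + m)) + h m"
    using assms[of m] by (simp add: add.commute)
  finally show ?case using Suc by simp
qed simp

lemma cis_2pi_int_mult: "cis (2 * pi * of_int z) = 1"
  by (metis cis_multiple_2pi Ints_of_int)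

lemma cis_cong_mod:
  assumes "int n dvd a - b" "n > 0"
  shows "cis (2 * pi * real k / real n * of_int a) = cis (2 * pi * real k / real n * of_int b)"
proof -
  obtain z where z: "a = b + int n * z" using assms(1) by (metis diff_add_cancel dvdE add.commute)
  have "2 * pi * real k / real n * of_int a
      = 2 * pi * real k / real n * of_int b + 2 * pi * of_int (int k * z)"
    using assms(2) unfolding z by (simp add: field_simps)
  thus ?thesis by (simp only: cis_mult[symmetric] cis_2pi_int_mult mult_1_right)
qed

lemma sum_cis_roots_of_unity:
  fixes m :: int
  assumes "n > 0"
  shows "(\<Sum>j<n. cis (2 * pi * of_int m / real n * real j)) = (if int n dvd m then of_nat n else 0)"
proof -
  let ?w = "cis (2 * pi * of_int m / real n)"
  have pow: "cis (2 * pi * of_int m / real n * real j) = ?w ^ j" for j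
    by (simp only: Complex.DeMoivre) (simp add: mult.commute)
  have wn: "?w ^ n = 1"
    using assms by (simp only: Complex.DeMoivre) (simp add: cis_2pi_int_mult)
  show ?thesis
  proof (cases "int n dvd m")
    case True
    then obtain z where "m = int n * z" by blast
    hence "2 * pi * of_int m / real n = 2 * pi * of_int z" using assms by simp
    hence "?w = 1" by (simp only: cis_2pi_int_mult)
    thus ?thesis unfolding pow using True by simp
  next
    \<comment> \<open>A ratio \<open>?w\<close> equal to 1 would make m / n an integer. Otherwise
      the geometric sum has numerator \<open>?w ^ n - 1\<close>, which is zero.\<close>
    case False
    have "?w \<noteq> 1"
    proof
      assume "?w = 1"
      hence "cos (2 * pi * of_int m / real n) = 1" by (metis cis.sel(1) one_complex.sel(1))
      then obtain z :: int where "2 * pi * of_int m / real n = of_int z * 2 * pi"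
        using cos_one_2pi_int by blast
      hence "2 * pi * of_int m = 2 * pi * (of_int z * real n)" using assms by (simp add: field_simps)
      hence "real_of_int m = of_int (z * int n)" by simp
      hence "m = z * int n" by (simp only: of_int_eq_iff)
      thus False using False by simp
    qed
    thus ?thesis unfolding pow using False wn by (simp add: geometric_sum)
  qed
qed

text \<open>Expand the squared modulus as a double sum over j and l and sum over k first:
  orthogonality of the characters leaves only the diagonal. The negative exponent is the sign for
  which \<open>dft_circulant\<close> turns a circulant into multiplication by
  \<open>circ_eig\<close>.\<close>

lemma dft_parseval:
  fixes x :: "nat \<Rightarrow> real"
  assumes "n > 0"
  shows "(\<Sum>k<n. (cmod (\<Sum>j<n. of_real (x j) * cis (- (2 * pi * real k / real n * real j))))\<^sup>2)
       = real n * (\<Sum>j<n. (x j)\<^sup>2)"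
proof -
  have tm: "cis (- (2 * pi * real k / real n * real j)) * cis (2 * pi * real k / real n * real l)
      = cis (2 * pi * of_int (int l - int j) / real n * real k)" for j k l
    by (simp add: cis_mult) (simp add: algebra_simps diff_divide_distrib)
  have sq: "complex_of_real ((cmod (\<Sum>j<n. of_real (x j) * cis (- (2 * pi * real k / real n * real j))))\<^sup>2)
     = (\<Sum>j<n. \<Sum>l<n. of_real (x j * x l) * cis (2 * pi * of_int (int l - int j) / real n * real k))" for k
    unfolding complex_norm_square cnj_sum sum_product tm[symmetric]
    by (intro sum.cong refl) (simp add: cis_cnj mult_ac)
  have "complex_of_real (\<Sum>k<n. (cmod (\<Sum>j<n. of_real (x j) * cis (- (2 * pi * real k / real n * real j))))\<^sup>2)
     = (\<Sum>k<n. \<Sum>j<n. \<Sum>l<n. of_real (x j * x l) * cis (2 * pi * of_int (int l - int j) / real n * real k))"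
    by (simp only: of_real_sum sq)
  also have "\<dots> = (\<Sum>j<n. \<Sum>k<n. \<Sum>l<n. of_real (x j * x l) * cis (2 * pi * of_int (int l - int j) / real n * real k))"
    by (rule sum.swap)
  also have "\<dots> = (\<Sum>j<n. \<Sum>l<n. \<Sum>k<n. of_real (x j * x l) * cis (2 * pi * of_int (int l - int j) / real n * real k))"
    by (intro sum.cong refl sum.swap)
  also have "\<dots> = (\<Sum>j<n. \<Sum>l<n. if l = j then of_real (x j * x l) * of_nat n else 0)"
  proof (intro sum.cong refl)
    fix j l assume "j \<in> {..<n}" "l \<in> {..<n}"
    hence "int n dvd int l - int j \<longleftrightarrow> l = j"
      using dvd_imp_le_int[of "int l - int j" "int n"] by (cases "l = j") auto
    thus "(\<Sum>k<n. of_real (x j * x l) * cis (2 * pi * of_int (int l - int j) / real n * real k))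
        = (if l = j then of_real (x j * x l) * of_nat n else 0)"
      unfolding sum_distrib_left[symmetric] sum_cis_roots_of_unity[OF assms] by simp
  qed
  also have "\<dots> = (\<Sum>j<n. of_real (x j * x j) * of_nat n)"
    by (simp add: sum.delta)
  also have "\<dots> = complex_of_real (real n * (\<Sum>j<n. (x j)\<^sup>2))"
    by (simp add: sum_distrib_left power2_eq_square mult_ac)
  finally show ?thesis by (simp only: of_real_eq_iff)
qed

section \<open>Diagonalising circulant matrices\<close>

lemma circulant_eigvec:
  assumes "i < n"
  shows "(\<Sum>j<n. of_real (circulant n c i j) * cis (2 * pi * real k / real n * real j))
       = cis (2 * pi * real k / real n * real i) * circ_eig n c k"
proof -
  have n: "n > 0" using assms by simp
  have "(\<Sum>j<n. of_real (circulant n c i j) * cis (2 * pi * real k / real n * real j))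
     = (\<Sum>l<n. cis (2 * pi * real k / real n * real i) * (of_real (c l) * cis (2 * pi * real k / real n * real l)))"
  \<comment> \<open>The substitution is l = (j - i) mod n. Reduction mod n does not change the
    exponential, so the phase belonging to i factors out.\<close>
  proof (rule sum.reindex_bij_witness[where i = "\<lambda>l. (i + l) mod n" and j = "\<lambda>j. nat ((int j - int i) mod int n)"])
    fix j assume j: "j \<in> {..<n}"
    have r: "int (nat ((int j - int i) mod int n)) = (int j - int i) mod int n" using n by simp
    have "int ((i + nat ((int j - int i) mod int n)) mod n) = int j"
      using j r by (simp add: zmod_int mod_simps)
    thus "(i + nat ((int j - int i) mod int n)) mod n = j" by linarith
    show "nat ((int j - int i) mod int n) \<in> {..<n}" using n
      by (metis lessThan_iff nat_less_iff of_nat_0_less_iff pos_mod_bound pos_mod_sign)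
    have "int n dvd int j - (int i + int (nat ((int j - int i) mod int n)))"
      unfolding r by (metis diff_diff_eq dvd_minus_mod)
    from cis_cong_mod[OF this n, of k]
    show "cis (2 * pi * real k / real n * real i) * (of_real (c (nat ((int j - int i) mod int n)))
           * cis (2 * pi * real k / real n * real (nat ((int j - int i) mod int n))))
         = of_real (circulant n c i j) * cis (2 * pi * real k / real n * real j)"
      by (simp add: circulant_def cis_mult distrib_left)
  next
    fix l assume l: "l \<in> {..<n}"
    have "(int ((i + l) mod n) - int i) mod int n = int l"
      using l by (simp add: zmod_int mod_simps)
    thus "nat ((int ((i + l) mod n) - int i) mod int n) = l" by simp
    show "(i + l) mod n \<in> {..<n}" using n by simp
  qed
  thus ?thesis by (simp add: circ_eig_def sum_distrib_left)
qed

text \<open>Left-eigenvector counterpart of \<open>circulant_eigvec\<close>: each column, weighted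
  with the conjugate character, yields a multiple of the conjugate character. All vectors stay real
  and only their transforms are complex.\<close>

lemma dft_circulant:
  assumes "n > 0"
  shows "(\<Sum>i<n. of_real (matvec n (circulant n c) x i) * cis (- (2 * pi * real k / real n * real i)))
       = circ_eig n c k * (\<Sum>j<n. of_real (x j) * cis (- (2 * pi * real k / real n * real j)))"
proof -
  have col: "(\<Sum>i<n. of_real (circulant n c i j) * cis (- (2 * pi * real k / real n * real i)))
     = cis (- (2 * pi * real k / real n * real j)) * circ_eig n c k" if j: "j < n" for j
  proof -
    have "(\<Sum>i<n. of_real (circulant n c i j) * cis (- (2 * pi * real k / real n * real i)))
     = (\<Sum>l<n. cis (- (2 * pi * real k / real n * real j)) * (of_real (c l) * cis (2 * pi * real k / real n * real l)))"
    \<comment> \<open>For fixed j the map sending i to (j - i) mod n is an involution, so it serves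
      as both witnesses.\<close>
    proof (rule sum.reindex_bij_witness[where i = "\<lambda>l. nat ((int j - int l) mod int n)" and j = "\<lambda>i. nat ((int j - int i) mod int n)"])
      fix i assume i: "i \<in> {..<n}"
      have r: "int (nat ((int j - int i) mod int n)) = (int j - int i) mod int n" using assms by simp
      show inv: "nat ((int j - int (nat ((int j - int i) mod int n))) mod int n) = i"
        unfolding r using i by (simp add: mod_simps)
      show "nat ((int j - int i) mod int n) \<in> {..<n}" using assms
        by (metis lessThan_iff nat_less_iff of_nat_0_less_iff pos_mod_bound pos_mod_sign)
      have "int n dvd - int i - (int (nat ((int j - int i) mod int n)) - int j)"
        unfolding r using dvd_minus_mod[of "int n" "int j - int i"] by (simp add: algebra_simps)
      from cis_cong_mod[OF this assms, of k]
      show "cis (- (2 * pi * real k / real n * real j)) * (of_real (c (nat ((int j - int i) mod int n)))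
             * cis (2 * pi * real k / real n * real (nat ((int j - int i) mod int n))))
           = of_real (circulant n c i j) * cis (- (2 * pi * real k / real n * real i))"
        by (simp add: circulant_def cis_mult right_diff_distrib)
    next
      fix l assume l: "l \<in> {..<n}"
      have r: "int (nat ((int j - int l) mod int n)) = (int j - int l) mod int n" using assms by simp
      show "nat ((int j - int (nat ((int j - int l) mod int n))) mod int n) = l"
        unfolding r using l by (simp add: mod_simps)
      show "nat ((int j - int l) mod int n) \<in> {..<n}" using assms
        by (metis lessThan_iff nat_less_iff of_nat_0_less_iff pos_mod_bound pos_mod_sign)
    qed
    thus ?thesis by (simp add: circ_eig_def sum_distrib_left)
  qed
  have "(\<Sum>i<n. of_real (matvec n (circulant n c) x i) * cis (- (2 * pi * real k / real n * real i)))
     = (\<Sum>i<n. \<Sum>j<n. of_real (x j) * (of_real (circulant n c i j) * cis (- (2 * pi * real k / real n * real i))))"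
    by (intro sum.cong refl) (simp add: matvec_def sum_distrib_right mult_ac)
  also have "\<dots> = (\<Sum>j<n. \<Sum>i<n. of_real (x j) * (of_real (circulant n c i j) * cis (- (2 * pi * real k / real n * real i))))"
    by (rule sum.swap)
  also have "\<dots> = (\<Sum>j<n. of_real (x j) * (cis (- (2 * pi * real k / real n * real j)) * circ_eig n c k))"
    by (intro sum.cong refl) (simp only: sum_distrib_left[symmetric] col lessThan_iff)
  finally show ?thesis by (simp add: sum_distrib_left mult_ac)
qed

text \<open>Parseval for the image vector. The weights multiplying the squared moduli of the
  eigenvalues are nonnegative and, by Parseval for x, sum to n times the squared norm of x; the two
  norm bounds below follow from this.\<close>

lemma vnorm_circulant_sq:
  assumes "n > 0"
  shows "real n * (vnorm n (matvec n (circulant n c) x))\<^sup>2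
    = (\<Sum>k<n. (cmod (circ_eig n c k))\<^sup>2
        * (cmod (\<Sum>j<n. of_real (x j) * cis (- (2 * pi * real k / real n * real j))))\<^sup>2)"
  using dft_parseval[OF assms, of "matvec n (circulant n c) x"]
  unfolding dft_circulant[OF assms] norm_mult power_mult_distrib
  by (simp add: vnorm_def sum_nonneg)

lemma vnorm_nonneg [simp]: "vnorm n x \<ge> 0"
  by (simp add: vnorm_def sum_nonneg)

lemma vnorm_circulant_ge:
  assumes "n > 0" "\<And>k. k < n \<Longrightarrow> a \<le> cmod (circ_eig n c k)" "a \<ge> 0"
  shows "a * vnorm n x \<le> vnorm n (matvec n (circulant n c) x)"
proof -
  have "real n * (a * vnorm n x)\<^sup>2 = a\<^sup>2 * (real n * (\<Sum>j<n. (x j)\<^sup>2))"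
    by (simp add: vnorm_def power_mult_distrib sum_nonneg)
  also have "\<dots> \<le> real n * (vnorm n (matvec n (circulant n c) x))\<^sup>2"
    unfolding vnorm_circulant_sq[OF assms(1)] dft_parseval[OF assms(1), symmetric]
    using assms by (subst sum_distrib_left) (intro sum_mono mult_right_mono power_mono; auto)
  finally show ?thesis using assms(1)
    by (intro power2_le_imp_le[OF _ vnorm_nonneg]) simp
qed

lemma vnorm_circulant_le:
  assumes "n > 0" "\<And>k. k < n \<Longrightarrow> cmod (circ_eig n c k) \<le> b"
  shows "vnorm n (matvec n (circulant n c) x) \<le> b * vnorm n x"
proof -
  have b: "b \<ge> 0" using assms(1) assms(2)[of 0] norm_ge_zero order_trans by blast
  have "real n * (vnorm n (matvec n (circulant n c) x))\<^sup>2 \<le> b\<^sup>2 * (real n * (\<Sum>j<n. (x j)\<^sup>2))"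
    unfolding vnorm_circulant_sq[OF assms(1)] dft_parseval[OF assms(1), symmetric]
    using assms by (subst sum_distrib_left) (intro sum_mono mult_right_mono power_mono; auto)
  also have "\<dots> = real n * (b * vnorm n x)\<^sup>2"
    by (simp add: vnorm_def power_mult_distrib sum_nonneg)
  finally show ?thesis using assms(1) b
    by (intro power2_le_imp_le[OF _ mult_nonneg_nonneg[OF _ vnorm_nonneg]]) simp_all
qed

section \<open>Singular values and condition number in terms of eigenvalue moduli\<close>

lemma unit_sphere_nonempty: "n > 0 \<Longrightarrow> unit_sphere n \<noteq> {}"
proof -
  assume n: "n > 0"
  have "(\<Sum>i<n. ((\<lambda>i. if i = 0 then 1 else 0 :: real) i)\<^sup>2) = (\<Sum>i<n. if i = 0 then 1 else 0)"
    by (intro sum.cong) auto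
  hence "(\<lambda>i. if i = 0 then 1 else 0) \<in> unit_sphere n"
    using n by (auto simp: unit_sphere_def vnorm_def)
  thus ?thesis by auto
qed

lemma vnorm_matvec_scale:
  assumes "vnorm n x \<noteq> 0"
  shows "\<exists>y\<in>unit_sphere n. vnorm n (matvec n A x) = vnorm n x * vnorm n (matvec n A y)"
proof
  let ?y = "\<lambda>i. if i < n then x i / vnorm n x else 0"
  have pos: "vnorm n x > 0" using assms vnorm_nonneg[of n x] by linarith
  have "matvec n A x = (\<lambda>i. vnorm n x * matvec n A ?y i)"
    using assms by (auto simp: matvec_def sum_distrib_left fun_eq_iff)
  hence "vnorm n (matvec n A x) = sqrt (\<Sum>i<n. (vnorm n x)\<^sup>2 * (matvec n A ?y i)\<^sup>2)"
    by (simp add: vnorm_def power_mult_distrib)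
  thus "vnorm n (matvec n A x) = vnorm n x * vnorm n (matvec n A ?y)"
    by (simp add: vnorm_def[of n "matvec n A ?y"] sum_distrib_left[symmetric] real_sqrt_mult)
  have "(\<Sum>i<n. (?y i)\<^sup>2) = (\<Sum>i<n. (x i)\<^sup>2) / (vnorm n x)\<^sup>2"
    by (simp add: sum_divide_distrib power_divide)
  also have "\<dots> = 1" using pos by (simp add: vnorm_def sum_nonneg)
  finally show "?y \<in> unit_sphere n"
    unfolding unit_sphere_def vnorm_def by simp
qed

text \<open>The real and imaginary parts of the Fourier vector are the two competitors: they have
  squared norms adding up to \<open>n\<close>, and so have their images, up to the factor \<open>|\<lambda>|\<^sup>2\<close>.\<close>

lemma vnorm_circulant_fourier:
  fixes n k :: nat
  defines "\<alpha> \<equiv> 2 * pi * real k / real n"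
  shows "(vnorm n (matvec n (circulant n c) (\<lambda>j. cos (\<alpha> * real j))))\<^sup>2
       + (vnorm n (matvec n (circulant n c) (\<lambda>j. sin (\<alpha> * real j))))\<^sup>2
       = real n * (cmod (circ_eig n c k))\<^sup>2"
    and "(vnorm n (\<lambda>j. cos (\<alpha> * real j)))\<^sup>2 + (vnorm n (\<lambda>j. sin (\<alpha> * real j)))\<^sup>2 = real n"
proof -
  have "(matvec n (circulant n c) (\<lambda>j. cos (\<alpha> * real j)) i)\<^sup>2
      + (matvec n (circulant n c) (\<lambda>j. sin (\<alpha> * real j)) i)\<^sup>2 = (cmod (circ_eig n c k))\<^sup>2" if "i < n" for i
  proof -
    have "(matvec n (circulant n c) (\<lambda>j. cos (\<alpha> * real j)) i)\<^sup>2
      + (matvec n (circulant n c) (\<lambda>j. sin (\<alpha> * real j)) i)\<^sup>2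
      = (cmod (\<Sum>j<n. of_real (circulant n c i j) * cis (\<alpha> * real j)))\<^sup>2"
      using that by (simp add: cmod_power2 matvec_def)
    also have "\<dots> = (cmod (circ_eig n c k))\<^sup>2"
      unfolding \<alpha>_def circulant_eigvec[OF that] by (simp add: norm_mult)
    finally show ?thesis .
  qed
  thus "(vnorm n (matvec n (circulant n c) (\<lambda>j. cos (\<alpha> * real j))))\<^sup>2
       + (vnorm n (matvec n (circulant n c) (\<lambda>j. sin (\<alpha> * real j))))\<^sup>2
       = real n * (cmod (circ_eig n c k))\<^sup>2"
    by (simp add: vnorm_def sum_nonneg sum.distrib[symmetric])
  show "(vnorm n (\<lambda>j. cos (\<alpha> * real j)))\<^sup>2 + (vnorm n (\<lambda>j. sin (\<alpha> * real j)))\<^sup>2 = real n"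
    by (simp add: vnorm_def sum_nonneg sum.distrib[symmetric])
qed

text \<open>Parseval confines the norm of the image of a real unit vector between the extreme
  moduli. Conversely, the eigenvectors are complex, so the bounds by \<open>sigma_min\<close> and
  \<open>sigma_max\<close> are applied to their real and imaginary parts separately; adding squares
  produces the factor n on both sides and leaves a comparison with the modulus of the
  eigenvalue.\<close>

lemma sigma_circulant_eq:
  assumes "n > 0"
  shows "sigma_min n (circulant n c) = Min ((\<lambda>k. cmod (circ_eig n c k)) ` {..<n})" (is "_ = ?a")
    and "sigma_max n (circulant n c) = Max ((\<lambda>k. cmod (circ_eig n c k)) ` {..<n})" (is "_ = ?b")
proof -
  let ?C = "circulant n c" and ?S = "unit_sphere n"
  let ?f = "\<lambda>x. vnorm n (matvec n ?C x)"
  have ne: "?S \<noteq> {}" using unit_sphere_nonempty assms by blast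
  have ak: "?a \<le> cmod (circ_eig n c k)" "cmod (circ_eig n c k) \<le> ?b" if "k < n" for k
    using that by (auto intro!: Min_le Max_ge)
  have "?a \<in> (\<lambda>k. cmod (circ_eig n c k)) ` {..<n}" "?b \<in> (\<lambda>k. cmod (circ_eig n c k)) ` {..<n}"
    using assms by (intro Min_in Max_in; auto)+
  then obtain k1 k2 where k: "?a = cmod (circ_eig n c k1)" "?b = cmod (circ_eig n c k2)" by auto
  have lo: "?a \<le> ?f x" and hi: "?f x \<le> ?b" if "x \<in> ?S" for x
    using vnorm_circulant_ge[OF assms ak(1), of x] vnorm_circulant_le[OF assms ak(2), of x] that k
    by (auto simp: unit_sphere_def)
  \<comment> \<open>Infimum and supremum over the reals have their order properties only for bounded
    sets.\<close>
  have bb: "bdd_below (?f ` ?S)" and ba: "bdd_above (?f ` ?S)"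
    using lo hi by (auto intro!: bdd_belowI2 bdd_aboveI2)
  have min0: "0 \<le> sigma_min n ?C" unfolding sigma_min_def by (intro cINF_greatest[OF ne]) simp
  obtain x0 where "x0 \<in> ?S" using ne by blast
  from cSUP_upper[OF this ba] have max0: "0 \<le> sigma_max n ?C"
    unfolding sigma_max_def using vnorm_nonneg order_trans by blast
  \<comment> \<open>The parts of a Fourier vector are not unit vectors, and the sine part may
    vanish. The bounds are therefore extended by homogeneity, norm zero included.\<close>
  have hom: "sigma_min n ?C * vnorm n x \<le> ?f x \<and> ?f x \<le> sigma_max n ?C * vnorm n x" for x
  proof (cases "vnorm n x = 0")
    case True
    thus ?thesis using vnorm_circulant_le[OF assms ak(2), of x] by simp
  next
    case False
    then obtain y where y: "y \<in> ?S" "?f x = vnorm n x * ?f y" using vnorm_matvec_scale by blast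
    have "sigma_min n ?C \<le> ?f y" "?f y \<le> sigma_max n ?C"
      unfolding sigma_min_def sigma_max_def
      by (rule cINF_lower[OF bb y(1)], rule cSUP_upper[OF y(1) ba])
    thus ?thesis unfolding y(2) by (simp add: mult.commute mult_left_mono)
  qed
  have eig: "sigma_min n ?C \<le> cmod (circ_eig n c k)" "cmod (circ_eig n c k) \<le> sigma_max n ?C" for k
  proof -
    let ?x = "\<lambda>j. cos (2 * pi * real k / real n * real j)" and ?y = "\<lambda>j. sin (2 * pi * real k / real n * real j)"
    note F = vnorm_circulant_fourier(1)[of n c k, symmetric]
    have G: "(s * vnorm n ?x)\<^sup>2 + (s * vnorm n ?y)\<^sup>2 = real n * s\<^sup>2" for s
      unfolding power_mult_distrib distrib_left[symmetric] vnorm_circulant_fourier(2)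
      by (rule mult.commute)
    have "real n * (sigma_min n ?C)\<^sup>2 = (sigma_min n ?C * vnorm n ?x)\<^sup>2 + (sigma_min n ?C * vnorm n ?y)\<^sup>2"
      by (rule G[symmetric])
    also have "\<dots> \<le> real n * (cmod (circ_eig n c k))\<^sup>2"
      unfolding F by (intro add_mono power_mono hom[THEN conjunct1] mult_nonneg_nonneg min0 vnorm_nonneg)
    finally show "sigma_min n ?C \<le> cmod (circ_eig n c k)"
      using assms by (intro power2_le_imp_le[OF _ norm_ge_zero]) simp
    have "real n * (cmod (circ_eig n c k))\<^sup>2 \<le> (sigma_max n ?C * vnorm n ?x)\<^sup>2 + (sigma_max n ?C * vnorm n ?y)\<^sup>2"
      unfolding F by (intro add_mono power_mono hom[THEN conjunct2] vnorm_nonneg)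
    also have "\<dots> = real n * (sigma_max n ?C)\<^sup>2"
      by (rule G)
    finally show "cmod (circ_eig n c k) \<le> sigma_max n ?C"
      using assms by (intro power2_le_imp_le[OF _ max0]) simp
  qed
  show "sigma_min n ?C = ?a"
  proof (rule antisym)
    show "sigma_min n ?C \<le> ?a" using eig(1)[of k1] by (simp only: k(1))
    show "?a \<le> sigma_min n ?C" unfolding sigma_min_def using ne lo by (intro cINF_greatest)
  qed
  show "sigma_max n ?C = ?b"
  proof (rule antisym)
    show "?b \<le> sigma_max n ?C" using eig(2)[of k2] by (simp only: k(2))
    show "sigma_max n ?C \<le> ?b" unfolding sigma_max_def using ne hi by (intro cSUP_least)
  qed
qed

lemma cond_number_circulant_le:
  assumes "n > 0" "a > 0" "\<And>k. k < n \<Longrightarrow> a \<le> cmod (circ_eig n c k)"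
    and "\<And>k. k < n \<Longrightarrow> cmod (circ_eig n c k) \<le> b"
  shows "cond_number n (circulant n c) \<le> ereal (b / a)"
proof -
  have 1: "a \<le> sigma_min n (circulant n c)"
    unfolding sigma_circulant_eq[OF assms(1)] using assms by (subst Min_ge_iff) auto
  have 2: "sigma_max n (circulant n c) \<le> b"
    unfolding sigma_circulant_eq[OF assms(1)] using assms by (subst Max_le_iff) auto
  have "b \<ge> 0" using assms(1) assms(4)[of 0] norm_ge_zero order_trans by blast
  thus ?thesis using 1 2 assms(2) unfolding cond_number_def
    by (auto intro!: frac_le)
qed

lemma borel_measurable_circ_eig:
  assumes "\<And>l. \<xi> l \<in> borel_measurable M"
  shows "(\<lambda>\<omega>. circ_eig n (\<lambda>l. \<xi> l \<omega>) k) \<in> borel_measurable M"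
  unfolding circ_eig_def
  by (intro borel_measurable_sum borel_measurable_times borel_measurable_const
      measurable_compose[OF assms borel_measurable_of_real])

text \<open>The defining infimum and supremum range over an uncountable sphere; the eigenvalue
  formula replaces them by a minimum and a maximum of finitely many measurable functions.\<close>

lemma borel_measurable_cond_number_circulant:
  assumes "n > 0" "\<And>l. \<xi> l \<in> borel_measurable M"
  shows "(\<lambda>\<omega>. cond_number n (circulant n (\<lambda>k. \<xi> k \<omega>))) \<in> borel_measurable M"
proof -
  have eig: "(\<lambda>\<omega>. cmod (circ_eig n (\<lambda>l. \<xi> l \<omega>) k)) \<in> borel_measurable M" for k
    by (rule measurable_compose[OF borel_measurable_circ_eig borel_measurable_norm]) (rule assms)
  have [measurable]: "(\<lambda>\<omega>. sigma_min n (circulant n (\<lambda>k. \<xi> k \<omega>))) \<in> borel_measurable M"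
    unfolding sigma_circulant_eq[OF assms(1)] by (intro borel_measurable_Min eig finite_lessThan)
  have [measurable]: "(\<lambda>\<omega>. sigma_max n (circulant n (\<lambda>k. \<xi> k \<omega>))) \<in> borel_measurable M"
    unfolding sigma_circulant_eq[OF assms(1)] by (intro borel_measurable_Max eig finite_lessThan)
  show ?thesis
    unfolding cond_number_def by measurable
qed

section \<open>Characteristic functions and small balls\<close>

text \<open>Expansion to fourth order gives 1 - cos x >= x^2/2 - x^4/24, and x^4 <= x^2 in the given
  range leaves at least 11/24 x^2.\<close>

lemma one_minus_cos_ge:
  fixes x :: real
  assumes "\<bar>x\<bar> \<le> 1"
  shows "x\<^sup>2 / 4 \<le> 1 - cos x"
proof -
  obtain t where t: "cos x = (\<Sum>m<4. cos_coeff m * x ^ m) + cos (t + 1/2 * real 4 * pi) / fact 4 * x ^ 4"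
    using Maclaurin_cos_expansion[of x 4] by blast
  have "{..<4::nat} = {0, 1, 2, 3}" by auto
  hence "(\<Sum>m<4. cos_coeff m * x ^ m) = 1 - x\<^sup>2 / 2"
    by (simp add: cos_coeff_def)
  moreover have "cos (t + 1/2 * real 4 * pi) / fact 4 * x ^ 4 \<le> 1 / 24 * x ^ 4"
    by (intro mult_right_mono) (auto simp: fact_numeral)
  moreover have "x ^ 4 \<le> x\<^sup>2"
  proof -
    have "x\<^sup>2 * x\<^sup>2 \<le> x\<^sup>2 * 1"
      using assms by (intro mult_left_mono) (auto simp: abs_square_le_1)
    thus ?thesis by (simp add: power4_eq_xxxx power2_eq_square mult.assoc)
  qed
  ultimately show ?thesis using t zero_le_power2[of x] by linarith
qed

text \<open>Parallelogram law for 1 - exp(iu) and 1 - exp(iv): the squared modulus of their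
  difference is 2 (1 - cos (u - v)), and the squared modulus of their sum is the nonnegative
  remainder displayed in \<open>eq\<close>.\<close>

lemma one_minus_cos_diff_le:
  fixes u v :: real
  shows "1 - cos (u - v) \<le> 2 * (1 - cos u) + 2 * (1 - cos v)"
proof -
  have eq: "2 * (2 * (1 - cos u) + 2 * (1 - cos v) - (1 - cos (u - v)))
      = (2 - cos u - cos v)\<^sup>2 + (sin u + sin v)\<^sup>2"
    using sin_cos_squared_add[of u] sin_cos_squared_add[of v] unfolding cos_diff power2_eq_square
    by (simp add: algebra_simps, linarith)
  have "0 \<le> 2 * (2 * (1 - cos u) + 2 * (1 - cos v) - (1 - cos (u - v)))"
    unfolding eq by simp
  thus ?thesis by (simp only: zero_le_mult_iff) simp
qed

text \<open>For independent X, X' with law \<mu> this is the expectation of 1 - cos (s (X - X')),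
  that is, one minus the characteristic function of the symmetrised variable; see
  \<open>char_gap_eq\<close>. Inequalities for 1 - cos thus pass to it by averaging.\<close>

definition char_gap :: "real measure \<Rightarrow> real \<Rightarrow> real" where
  "char_gap \<mu> s = 1 - (cmod (char \<mu> s))\<^sup>2"

context real_distribution
begin

lemma integrable_cos: "integrable M (\<lambda>x. cos (s * x))"
  and integrable_sin: "integrable M (\<lambda>x. sin (s * x))"
  by (auto intro!: integrable_const_bound[of _ 1])

lemma cmod_char_sq: "(cmod (char M s))\<^sup>2 = (\<integral>x. cos (s * x) \<partial>M)\<^sup>2 + (\<integral>x. sin (s * x) \<partial>M)\<^sup>2"
proof -
  have i: "integrable M (\<lambda>x. iexp (s * x))"
    by (intro integrable_iexp) auto
  have "Re (char M s) = (\<integral>x. cos (s * x) \<partial>M)" "Im (char M s) = (\<integral>x. sin (s * x) \<partial>M)"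
    unfolding char_def integral_Re[OF i, symmetric] integral_Im[OF i, symmetric]
    by (simp_all add: Re_exp Im_exp)
  thus ?thesis by (simp add: cmod_power2)
qed

lemma char_gap_inner:
  "(\<integral>y. 1 - cos (s * (x - y)) \<partial>M)
     = 1 - (cos (s * x) * (\<integral>y. cos (s * y) \<partial>M) + sin (s * x) * (\<integral>y. sin (s * y) \<partial>M))"
  using prob_space by (simp add: right_diff_distrib cos_diff integrable_cos integrable_sin)

lemma integrable_char_gap_inner: "integrable M (\<lambda>x. \<integral>y. 1 - cos (s * (x - y)) \<partial>M)"
  unfolding char_gap_inner by (auto simp: integrable_cos integrable_sin)

lemma integrable_one_minus_cos: "integrable M (\<lambda>y. 1 - cos (s * (x - y)))"
  by (simp add: right_diff_distrib cos_diff integrable_cos integrable_sin)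

lemma char_gap_eq: "char_gap M s = (\<integral>x. \<integral>y. 1 - cos (s * (x - y)) \<partial>M \<partial>M)"
  unfolding char_gap_inner char_gap_def cmod_char_sq
  using prob_space by (simp add: integrable_cos integrable_sin power2_eq_square)

text \<open>Average \<open>one_minus_cos_diff_le\<close> over independent pairs. Later this trades
  two large frequencies for their small difference.\<close>

lemma char_gap_diff_le: "char_gap M (a - b) \<le> 2 * char_gap M a + 2 * char_gap M b"
proof -
  let ?g = "\<lambda>s x. \<integral>y. 1 - cos (s * (x - y)) \<partial>M"
  have "?g (a - b) x \<le> 2 * ?g a x + 2 * ?g b x" for x
  proof -
    have "?g (a - b) x \<le> (\<integral>y. 2 * (1 - cos (a * (x - y))) + 2 * (1 - cos (b * (x - y))) \<partial>M)"
    proof (intro integral_mono integrable_one_minus_cos Bochner_Integration.integrable_add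
        integrable_mult_right)
      fix y show "1 - cos ((a - b) * (x - y)) \<le> 2 * (1 - cos (a * (x - y))) + 2 * (1 - cos (b * (x - y)))"
        using one_minus_cos_diff_le[of "a * (x - y)" "b * (x - y)"] by (simp add: left_diff_distrib)
    qed
    also have "\<dots> = 2 * ?g a x + 2 * ?g b x"
      by (subst Bochner_Integration.integral_add)
        (auto intro!: integrable_mult_right integrable_one_minus_cos simp del: integral_diff right_diff_distrib_numeral)
    finally show ?thesis .
  qed
  hence "char_gap M (a - b) \<le> (\<integral>x. 2 * ?g a x + 2 * ?g b x \<partial>M)"
    unfolding char_gap_eq
    by (intro integral_mono integrable_char_gap_inner Bochner_Integration.integrable_add integrable_mult_right)
  also have "\<dots> = 2 * char_gap M a + 2 * char_gap M b"
    unfolding char_gap_eq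
    by (subst Bochner_Integration.integral_add) (auto intro!: integrable_mult_right integrable_char_gap_inner)
  finally show ?thesis .
qed

lemma cmod_char_le_exp_gap: "cmod (char M s) \<le> exp (- (char_gap M s / 2))"
proof (rule power2_le_imp_le)
  have "(cmod (char M s))\<^sup>2 = 1 + (- char_gap M s)" by (simp add: char_gap_def)
  also have "\<dots> \<le> exp (- char_gap M s)" by (rule exp_ge_add_one_self)
  also have "\<dots> = (exp (- (char_gap M s / 2)))\<^sup>2" by (simp add: power2_eq_square exp_add[symmetric])
  finally show "(cmod (char M s))\<^sup>2 \<le> (exp (- (char_gap M s / 2)))\<^sup>2" .
qed simp

text \<open>Pairs with |x|, |y| <= K and |x - y| > 1 contribute at least s^2/4, because s (x - y)
  then lies in the range of \<open>one_minus_cos_ge\<close>. An independent pair is of this kind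
  with probability at least m^2 - (1 - q), where m is the mass of [-K, K].\<close>

lemma char_gap_ge:
  assumes K: "K > 0" and q: "0 < q" "q < 1"
    and conc: "\<And>u. measure M {x. \<bar>x - u\<bar> \<le> 1} \<le> 1 - q"
    and tail: "measure M {x. \<bar>x\<bar> > K} \<le> q / 2"
    and s: "\<bar>s\<bar> \<le> 1 / (2 * K)"
  shows "q\<^sup>2 / 16 * s\<^sup>2 \<le> char_gap M s"
proof -
  define m where "m = measure M {x. \<bar>x\<bar> \<le> K}"
  have "m = 1 - measure M {x. \<bar>x\<bar> > K}"
  proof -
    have "{x. \<bar>x\<bar> \<le> K} = space M - {x. \<bar>x\<bar> > K}" by auto
    thus ?thesis unfolding m_def by (simp add: prob_compl del: space_eq_univ)
  qed
  hence m: "1 - q / 2 \<le> m" using tail by linarith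
  have inner: "s\<^sup>2 / 4 * (indicator {x. \<bar>x\<bar> \<le> K} x * m - (1 - q)) \<le> (\<integral>y. 1 - cos (s * (x - y)) \<partial>M)" for x
  proof -
    \<comment> \<open>The difference of indicators is 1 on the useful pairs and at most 0 elsewhere,
      so the bound holds for all y and can be integrated.\<close>
    have pt: "s\<^sup>2 / 4 * (indicator {x. \<bar>x\<bar> \<le> K} x * indicator {y. \<bar>y\<bar> \<le> K} y - indicator {y. \<bar>y - x\<bar> \<le> 1} y)
        \<le> 1 - cos (s * (x - y))" for y
    proof (cases "\<bar>x\<bar> \<le> K \<and> \<bar>y\<bar> \<le> K \<and> \<bar>y - x\<bar> > 1")
      case True
      have "\<bar>s * (x - y)\<bar> \<le> 1 / (2 * K) * (2 * K)"
        unfolding abs_mult using s True by (intro mult_mono) auto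
      hence "\<bar>s * (x - y)\<bar> \<le> 1" using K by simp
      hence "(s * (x - y))\<^sup>2 / 4 \<le> 1 - cos (s * (x - y))" by (rule one_minus_cos_ge)
      moreover have "s\<^sup>2 * 1 \<le> s\<^sup>2 * (x - y)\<^sup>2"
        using True by (intro mult_left_mono) (auto simp: abs_minus_commute abs_le_square_iff[of 1 "x - y", simplified, symmetric])
      ultimately show ?thesis using True by (simp add: indicator_def power_mult_distrib)
    next
      case False
      hence "indicator {x. \<bar>x\<bar> \<le> K} x * indicator {y. \<bar>y\<bar> \<le> K} y - indicator {y. \<bar>y - x\<bar> \<le> 1} y \<le> (0::real)"
        by (auto simp: indicator_def)
      hence "s\<^sup>2 / 4 * (indicator {x. \<bar>x\<bar> \<le> K} x * indicator {y. \<bar>y\<bar> \<le> K} y - indicator {y. \<bar>y - x\<bar> \<le> 1} y) \<le> 0"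
        by (intro mult_nonneg_nonpos) auto
      also have "0 \<le> 1 - cos (s * (x - y))" by simp
      finally show ?thesis .
    qed
    have "s\<^sup>2 / 4 * (indicator {x. \<bar>x\<bar> \<le> K} x * m - (1 - q))
        \<le> s\<^sup>2 / 4 * (indicator {x. \<bar>x\<bar> \<le> K} x * m - measure M {y. \<bar>y - x\<bar> \<le> 1})"
      using conc[of x] by (intro mult_left_mono) auto
    also have "\<dots> = (\<integral>y. s\<^sup>2 / 4 * (indicator {x. \<bar>x\<bar> \<le> K} x * indicator {y. \<bar>y\<bar> \<le> K} y - indicator {y. \<bar>y - x\<bar> \<le> 1} y) \<partial>M)"
      unfolding m_def by (simp add: emeasure_eq_measure)
    also have "\<dots> \<le> (\<integral>y. 1 - cos (s * (x - y)) \<partial>M)"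
      by (intro integral_mono pt integrable_one_minus_cos) (auto simp: emeasure_eq_measure)
    finally show ?thesis .
  qed
  \<comment> \<open>The tail bound q/2 is calibrated so that (1 - q/2)^2 - (1 - q) = q^2/4 remains
    positive.\<close>
  have "(1 - q / 2) * (1 - q / 2) \<le> m * m" using m q by (intro mult_mono) auto
  hence "q\<^sup>2 / 4 \<le> m * m - (1 - q)" by (simp add: power2_eq_square field_simps)
  hence "s\<^sup>2 / 4 * (q\<^sup>2 / 4) \<le> s\<^sup>2 / 4 * (m * m - (1 - q))" by (intro mult_left_mono) auto
  hence "q\<^sup>2 / 16 * s\<^sup>2 \<le> s\<^sup>2 / 4 * (m * m - (1 - q))" by (simp add: mult_ac)
  also have "\<dots> = (\<integral>x. s\<^sup>2 / 4 * (indicator {x. \<bar>x\<bar> \<le> K} x * m - (1 - q)) \<partial>M)"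
    unfolding m_def using prob_space by (simp add: emeasure_eq_measure)
  also have "\<dots> \<le> char_gap M s"
    unfolding char_gap_eq
    by (intro integral_mono inner integrable_char_gap_inner) (auto simp: emeasure_eq_measure)
  finally show ?thesis .
qed

end

section \<open>Gaussian averages of characteristic functions and the small ball inequality\<close>

lemma gauss_exp_square:
  fixes a :: real
  assumes "a > - 1 / 2"
  shows "integrable std_normal_distribution (\<lambda>x. exp (- a * x\<^sup>2))"
    and "(\<integral>x. exp (- a * x\<^sup>2) \<partial>std_normal_distribution) = 1 / sqrt (1 + 2 * a)"
proof -
  define \<sigma> where "\<sigma> = 1 / sqrt (1 + 2 * a)"
  have s: "\<sigma> > 0" "\<sigma>\<^sup>2 = 1 / (1 + 2 * a)" using assms by (auto simp: \<sigma>_def power_divide)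
  have eq: "std_normal_density x * exp (- a * x\<^sup>2) = \<sigma> * normal_density 0 \<sigma> x" for x
  proof -
    have "- x\<^sup>2 / 2 + - a * x\<^sup>2 = - x\<^sup>2 / (2 * \<sigma>\<^sup>2)"
      unfolding s(2) by (simp add: algebra_simps add_divide_distrib)
    hence "exp (- x\<^sup>2 / 2) * exp (- a * x\<^sup>2) = exp (- x\<^sup>2 / (2 * \<sigma>\<^sup>2))"
      by (simp only: exp_add[symmetric])
    thus ?thesis using s(1)
      by (simp add: normal_density_def real_sqrt_mult)
  qed
  show "integrable std_normal_distribution (\<lambda>x. exp (- a * x\<^sup>2))"
    by (subst integrable_density) (use s(1) in \<open>auto simp: eq[simplified] normal_density_nonneg\<close>)
  show "(\<integral>x. exp (- a * x\<^sup>2) \<partial>std_normal_distribution) = 1 / sqrt (1 + 2 * a)"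
    by (subst integral_density) (use s(1) in \<open>auto simp: eq[simplified] normal_density_nonneg \<sigma>_def[symmetric]\<close>)
qed

text \<open>The Gaussian weight is its own characteristic function, so
  \<open>exp (- (X\<^sup>2 + Y\<^sup>2) / 2t\<^sup>2)\<close> is an average of characters of \<open>(X, Y)\<close>; this replaces Esseen's inequality.\<close>

lemma (in prob_space) gauss_weight_eq_integral_char:
  assumes [measurable]: "X \<in> borel_measurable M" "Y \<in> borel_measurable M"
  shows "complex_of_real (\<integral>\<omega>. exp (- ((X \<omega>)\<^sup>2 + (Y \<omega>)\<^sup>2) / 2) \<partial>M)
    = (\<integral>g. \<integral>h. (\<integral>\<omega>. iexp (g * X \<omega> + h * Y \<omega>) \<partial>M) \<partial>std_normal_distribution \<partial>std_normal_distribution)"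
proof -
  interpret N: real_distribution std_normal_distribution by (rule real_dist_normal_dist)
  interpret P: pair_prob_space M std_normal_distribution ..
  have ch: "(\<integral>g. iexp (g * x) \<partial>std_normal_distribution) = of_real (exp (- x\<^sup>2 / 2))" for x
    using fun_cong[OF char_std_normal_distribution, of x] by (simp add: char_def mult.commute)
  \<comment> \<open>All integrands are bounded by 1 on a product of probability spaces, which
    justifies every exchange of integrals.\<close>
  have swap: "(\<integral>g. (\<integral>\<omega>. f \<omega> g \<partial>M) \<partial>std_normal_distribution) = (\<integral>\<omega>. (\<integral>g. f \<omega> g \<partial>std_normal_distribution) \<partial>M)"
    if "case_prod f \<in> borel_measurable (M \<Otimes>\<^sub>M std_normal_distribution)" "\<And>\<omega> g. cmod (f \<omega> g) \<le> 1"
    for f :: "'a \<Rightarrow> real \<Rightarrow> complex"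
    using that by (intro P.Fubini_integral P.integrable_const_bound[of _ 1]) auto
  have "(\<integral>h. (\<integral>\<omega>. iexp (g * X \<omega> + h * Y \<omega>) \<partial>M) \<partial>std_normal_distribution)
      = (\<integral>\<omega>. iexp (g * X \<omega>) * of_real (exp (- (Y \<omega>)\<^sup>2 / 2)) \<partial>M)" for g
  proof -
    have "(\<integral>h. (\<integral>\<omega>. iexp (g * X \<omega> + h * Y \<omega>) \<partial>M) \<partial>std_normal_distribution)
        = (\<integral>\<omega>. (\<integral>h. iexp (g * X \<omega> + h * Y \<omega>) \<partial>std_normal_distribution) \<partial>M)"
      by (rule swap) (simp_all del: of_real_add of_real_mult)
    also have "\<dots> = (\<integral>\<omega>. iexp (g * X \<omega>) * of_real (exp (- (Y \<omega>)\<^sup>2 / 2)) \<partial>M)"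
      unfolding ch[symmetric] by (simp add: distrib_left exp_add)
    finally show ?thesis .
  qed
  hence "(\<integral>g. \<integral>h. (\<integral>\<omega>. iexp (g * X \<omega> + h * Y \<omega>) \<partial>M) \<partial>std_normal_distribution \<partial>std_normal_distribution)
      = (\<integral>g. (\<integral>\<omega>. iexp (g * X \<omega>) * of_real (exp (- (Y \<omega>)\<^sup>2 / 2)) \<partial>M) \<partial>std_normal_distribution)"
    by simp
  also have "\<dots> = (\<integral>\<omega>. (\<integral>g. iexp (g * X \<omega>) * of_real (exp (- (Y \<omega>)\<^sup>2 / 2)) \<partial>std_normal_distribution) \<partial>M)"
    by (rule swap) (simp_all add: norm_mult del: of_real_mult)
  also have "\<dots> = (\<integral>\<omega>. of_real (exp (- ((X \<omega>)\<^sup>2 + (Y \<omega>)\<^sup>2) / 2)) \<partial>M)"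
    unfolding integral_mult_left_zero ch of_real_mult[symmetric] exp_add[symmetric]
    by (simp add: diff_divide_distrib)
  finally show ?thesis by simp
qed

text \<open>On the ball, e^(1/2) times the Gaussian weight is at least 1, so the probability is
  bounded by a Gaussian average of the characteristic function at scale 1/t. The three terms of
  \<open>bound\<close> are meant for low frequencies (Gaussian decay), medium ones (a uniformly
  small \<delta>) and high ones, where the trivial bound 1 is absorbed by a growing weight with a
  tiny factor \<eta>.\<close>

lemma (in prob_space) small_ball_le:
  assumes [measurable]: "X \<in> borel_measurable M" "Y \<in> borel_measurable M"
    and t: "t > 0" and ab: "a \<ge> 0" "b \<ge> 0" "\<delta> \<ge> 0" "\<eta> \<ge> 0"
    and bound: "\<And>g h. cmod (\<integral>\<omega>. iexp (g / t * X \<omega> + h / t * Y \<omega>) \<partial>M)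
        \<le> exp (- a * g\<^sup>2) * exp (- b * h\<^sup>2) + \<delta> + \<eta> * (exp (g\<^sup>2 / 4) * exp (h\<^sup>2 / 4))"
  shows "prob {\<omega> \<in> space M. (X \<omega>)\<^sup>2 + (Y \<omega>)\<^sup>2 \<le> t\<^sup>2}
      \<le> exp (1 / 2) * (1 / (sqrt (1 + 2 * a) * sqrt (1 + 2 * b)) + \<delta> + 2 * \<eta>)"
proof -
  let ?N = "std_normal_distribution"
  interpret N: real_distribution ?N by (rule real_dist_normal_dist)
  let ?B = "\<lambda>g h. exp (- a * g\<^sup>2) * exp (- b * h\<^sup>2) + \<delta> + \<eta> * (exp (g\<^sup>2 / 4) * exp (h\<^sup>2 / 4))"
  have G: "integrable ?N (\<lambda>x. exp (- a * x\<^sup>2))" "integrable ?N (\<lambda>x. exp (- b * x\<^sup>2))"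
      "integrable ?N (\<lambda>x. exp (x\<^sup>2 / 4))"
      "(\<integral>x. exp (- a * x\<^sup>2) \<partial>?N) = 1 / sqrt (1 + 2 * a)"
      "(\<integral>x. exp (- b * x\<^sup>2) \<partial>?N) = 1 / sqrt (1 + 2 * b)"
      "(\<integral>x. exp (x\<^sup>2 / 4) \<partial>?N) = sqrt 2"
    using gauss_exp_square[of a] gauss_exp_square[of b] gauss_exp_square[of "- 1 / 4"] ab
    by (auto simp: real_sqrt_divide)
  have Bi: "integrable ?N (\<lambda>h. ?B g h)" for g
    using G(2,3) by (intro Bochner_Integration.integrable_add integrable_mult_right) auto
  have Bint: "(\<integral>h. ?B g h \<partial>?N) = exp (- a * g\<^sup>2) / sqrt (1 + 2 * b) + \<delta> + \<eta> * (exp (g\<^sup>2 / 4) * sqrt 2)" for g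
    using G N.prob_space by simp
  have B2i: "integrable ?N (\<lambda>g. \<integral>h. ?B g h \<partial>?N)"
    unfolding Bint using G by simp
  have B0: "0 \<le> ?B g h" for g h using ab by simp
  have aux: "0 \<le> 1 / 2 + - r / 2" if "r \<le> 1" for r :: real using that by simp
  define E where "E = (\<lambda>\<omega>. exp (- ((X \<omega> / t)\<^sup>2 + (Y \<omega> / t)\<^sup>2) / 2))"
  have [measurable]: "E \<in> borel_measurable M" unfolding E_def by measurable
  have Ei: "integrable M E" by (intro integrable_const_bound[of _ 1]) (auto simp: E_def)
  have "prob {\<omega> \<in> space M. (X \<omega>)\<^sup>2 + (Y \<omega>)\<^sup>2 \<le> t\<^sup>2}
      = (\<integral>\<omega>. indicator {\<omega> \<in> space M. (X \<omega>)\<^sup>2 + (Y \<omega>)\<^sup>2 \<le> t\<^sup>2} \<omega> \<partial>M)"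
    by simp
  also have "\<dots> \<le> (\<integral>\<omega>. exp (1/2) * E \<omega> \<partial>M)"
  proof (intro integral_mono integrable_mult_right Ei)
    fix \<omega>
    show "indicator {\<omega> \<in> space M. (X \<omega>)\<^sup>2 + (Y \<omega>)\<^sup>2 \<le> t\<^sup>2} \<omega> \<le> exp (1/2) * E \<omega>"
    proof (cases "(X \<omega>)\<^sup>2 + (Y \<omega>)\<^sup>2 \<le> t\<^sup>2")
      case True
      hence "(X \<omega> / t)\<^sup>2 + (Y \<omega> / t)\<^sup>2 \<le> 1"
        using t by (simp add: power_divide add_divide_distrib[symmetric])
      hence "0 \<le> 1 / 2 + - ((X \<omega> / t)\<^sup>2 + (Y \<omega> / t)\<^sup>2) / 2"
        by (rule aux)
      hence "1 \<le> exp (1/2) * E \<omega>" unfolding E_def exp_add[symmetric] one_le_exp_iff .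
      thus ?thesis by (simp add: indicator_def)
    qed (auto simp: indicator_def E_def)
  qed (auto simp: emeasure_eq_measure)
  also have "\<dots> = exp (1/2) * (\<integral>\<omega>. E \<omega> \<partial>M)" by simp
  also have "(\<integral>\<omega>. E \<omega> \<partial>M) \<le> (\<integral>g. (\<integral>h. ?B g h \<partial>?N) \<partial>?N)"
  proof -
    have "(\<integral>\<omega>. E \<omega> \<partial>M) \<le> cmod (of_real (\<integral>\<omega>. E \<omega> \<partial>M))" by (simp add: abs_ge_self)
    also have "\<dots> = cmod (\<integral>g. \<integral>h. (\<integral>\<omega>. iexp (g / t * X \<omega> + h / t * Y \<omega>) \<partial>M) \<partial>?N \<partial>?N)"
      unfolding E_def by (subst gauss_weight_eq_integral_char) auto
    also have "\<dots> \<le> (\<integral>g. cmod (\<integral>h. (\<integral>\<omega>. iexp (g / t * X \<omega> + h / t * Y \<omega>) \<partial>M) \<partial>?N) \<partial>?N)"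
      by (rule integral_norm_bound)
    also have "\<dots> \<le> (\<integral>g. (\<integral>h. ?B g h \<partial>?N) \<partial>?N)"
    proof (rule integral_mono'[OF B2i])
      fix g
      have "cmod (\<integral>h. (\<integral>\<omega>. iexp (g / t * X \<omega> + h / t * Y \<omega>) \<partial>M) \<partial>?N)
          \<le> (\<integral>h. cmod (\<integral>\<omega>. iexp (g / t * X \<omega> + h / t * Y \<omega>) \<partial>M) \<partial>?N)"
        by (rule integral_norm_bound)
      also have "\<dots> \<le> (\<integral>h. ?B g h \<partial>?N)"
        by (rule integral_mono'[OF Bi bound B0])
      finally show "cmod (\<integral>h. (\<integral>\<omega>. iexp (g / t * X \<omega> + h / t * Y \<omega>) \<partial>M) \<partial>?N) \<le> (\<integral>h. ?B g h \<partial>?N)" .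
      show "0 \<le> (\<integral>h. ?B g h \<partial>?N)" by (intro Bochner_Integration.integral_nonneg B0)
    qed
    finally show ?thesis .
  qed
  \<comment> \<open>Each of the two growing weights integrates to sqrt 2, hence the factor 2 in
    front of \<eta>.\<close>
  also have "(\<integral>g. (\<integral>h. ?B g h \<partial>?N) \<partial>?N) = 1 / (sqrt (1 + 2 * a) * sqrt (1 + 2 * b)) + \<delta> + 2 * \<eta>"
    unfolding Bint using G N.prob_space by simp
  finally show ?thesis by simp
qed

section \<open>Sums over roots of unity\<close>

text \<open>Since cos^2 x = 1/2 + cos(2x)/2, the deviation from n/2 is a sum over roots of unity of
  doubled frequency, which vanishes when n does not divide 2k. The excluded k are those for which
  all the roots involved are real.\<close>

lemma sum_cos_sq_roots:
  assumes "n > 0" "\<not> n dvd 2 * k"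
  shows "(\<Sum>j<n. (cos (2 * pi * real k / real n * real j - \<theta>))\<^sup>2) = real n / 2"
proof -
  let ?\<alpha> = "2 * pi * real k / real n"
  have "\<not> int n dvd int (2 * k)" using assms(2) by (simp only: int_dvd_int_iff) simp
  hence "0 = cis (- 2 * \<theta>) * (\<Sum>j<n. cis (2 * pi * of_int (int (2 * k)) / real n * real j))"
    by (simp only: sum_cis_roots_of_unity[OF assms(1)] if_False mult_zero_right)
  also have "\<dots> = (\<Sum>j<n. cis (2 * (?\<alpha> * real j - \<theta>)))"
    unfolding sum_distrib_left cis_mult by (intro sum.cong refl arg_cong[of _ _ cis]) (simp add: algebra_simps)
  finally have "0 = Re (\<Sum>j<n. cis (2 * (?\<alpha> * real j - \<theta>)))" by simp
  hence z: "(\<Sum>j<n. cos (2 * (?\<alpha> * real j - \<theta>))) = 0" by simp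
  have cos_sq: "(cos x)\<^sup>2 = 1 / 2 + cos (2 * x) / 2" for x :: real
    by (simp add: cos_double_cos diff_divide_distrib)
  have "(\<Sum>j<n. (cos (?\<alpha> * real j - \<theta>))\<^sup>2) = (\<Sum>j<n. 1 / 2 + cos (2 * (?\<alpha> * real j - \<theta>)) / 2)"
    by (intro sum.cong refl) (rule cos_sq)
  also have "\<dots> = real n / 2 + (\<Sum>j<n. cos (2 * (?\<alpha> * real j - \<theta>))) / 2"
    by (simp only: sum.distrib sum_divide_distrib[symmetric]) simp
  finally show ?thesis using z by simp
qed

lemma sum_sin_sq_roots:
  assumes "n > 0" "\<not> n dvd 2 * k"
  shows "(\<Sum>j<n. (sin (2 * pi * real k / real n * real j - \<theta>))\<^sup>2) = real n / 2"
  using sum_cos_sq_roots[OF assms, of "\<theta> + pi / 2"]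
  by (simp add: cos_diff sin_diff cos_add sin_add algebra_simps)

lemma sum_gap_small_ge:
  fixes \<Psi> :: "real \<Rightarrow> real"
  assumes n: "n > 0" "\<not> n dvd 2 * k"
    and low: "\<And>s. \<bar>s\<bar> \<le> c \<Longrightarrow> \<gamma> * s\<^sup>2 \<le> \<Psi> s" and r: "\<bar>r\<bar> \<le> c"
  shows "\<gamma> * r\<^sup>2 * real n / 2 \<le> (\<Sum>j<n. \<Psi> (r * cos (2 * pi * real k / real n * real j - \<theta>)))"
proof -
  have "\<gamma> * r\<^sup>2 * real n / 2 = (\<Sum>j<n. \<gamma> * (r * cos (2 * pi * real k / real n * real j - \<theta>))\<^sup>2)"
    unfolding power_mult_distrib sum_distrib_left[symmetric] sum_cos_sq_roots[OF n] by simp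
  also have "\<dots> \<le> (\<Sum>j<n. \<Psi> (r * cos (2 * pi * real k / real n * real j - \<theta>)))"
  proof (intro sum_mono low)
    fix j
    have "\<bar>r\<bar> * \<bar>cos (2 * pi * real k / real n * real j - \<theta>)\<bar> \<le> \<bar>r\<bar> * 1"
      by (intro mult_left_mono) auto
    thus "\<bar>r * cos (2 * pi * real k / real n * real j - \<theta>)\<bar> \<le> c" using r by (simp add: abs_mult)
  qed
  finally show ?thesis .
qed

text \<open>Take the first p at which the amplitude 2 r |sin (p \<beta>)| reaches c/2. One step
  raises the amplitude by at most 2 r |\<beta>| <= c/2, so it cannot jump past c.\<close>

lemma exists_multiple_sin_between:
  fixes \<beta> c r :: real
  assumes \<beta>: "\<beta> \<noteq> 0" "4 * r * \<bar>\<beta>\<bar> \<le> c" and r: "c > 0" "c \<le> r"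
  shows "\<exists>p::nat. c / 2 \<le> 2 * r * \<bar>sin (real p * \<beta>)\<bar> \<and> 2 * r * \<bar>sin (real p * \<beta>)\<bar> \<le> c"
proof -
  define f where "f p = 2 * r * \<bar>sin (real p * \<beta>)\<bar>" for p :: nat
  have r0: "r > 0" using r by simp
  have "r * (4 * \<bar>\<beta>\<bar>) \<le> r * 1" using \<beta>(2) r(2) by (simp add: mult_ac)
  hence b: "\<bar>\<beta>\<bar> \<le> 1 / 4" using r0 by simp
  \<comment> \<open>For this P the angle P |\<beta>| lies between pi/6 and pi/6 + 1/4, hence below
    pi/2. Its sine is at least 1/2 and the amplitude at least r >= c, so some p reaches c/2.\<close>
  define P where "P = nat \<lceil>pi / 6 / \<bar>\<beta>\<bar>\<rceil>"
  have "pi / 6 / \<bar>\<beta>\<bar> \<le> real P" "real P \<le> pi / 6 / \<bar>\<beta>\<bar> + 1"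
    unfolding P_def using real_nat_ceiling_ge[of "pi / 6 / \<bar>\<beta>\<bar>"]
      of_int_ceiling_le_add_one[of "pi / 6 / \<bar>\<beta>\<bar>"] by simp_all
  hence "pi / 6 / \<bar>\<beta>\<bar> * \<bar>\<beta>\<bar> \<le> real P * \<bar>\<beta>\<bar>" "real P * \<bar>\<beta>\<bar> \<le> (pi / 6 / \<bar>\<beta>\<bar> + 1) * \<bar>\<beta>\<bar>"
    by (simp_all only: mult_right_mono abs_ge_zero)
  hence P: "pi / 6 \<le> real P * \<bar>\<beta>\<bar>" "real P * \<bar>\<beta>\<bar> \<le> pi / 6 + \<bar>\<beta>\<bar>"
    using \<beta>(1) unfolding distrib_right nonzero_eq_divide_eq[symmetric] by simp_all
  have "real P * \<bar>\<beta>\<bar> \<le> pi / 2" using P(2) b pi_gt3 by linarith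
  hence "sin (pi / 6) \<le> sin (real P * \<bar>\<beta>\<bar>)" using P(1) pi_gt3 by (intro sin_monotone_2pi_le) auto
  hence "1 / 2 \<le> sin (real P * \<bar>\<beta>\<bar>)" by (simp add: sin_30)
  moreover have "\<bar>sin (real P * \<bar>\<beta>\<bar>)\<bar> = \<bar>sin (real P * \<beta>)\<bar>" by (cases "\<beta> \<ge> 0") auto
  ultimately have "1 / 2 \<le> \<bar>sin (real P * \<beta>)\<bar>" by linarith
  hence "2 * r * (1 / 2) \<le> f P" unfolding f_def using r0 by (intro mult_left_mono) auto
  hence ex: "c / 2 \<le> f P" using r by simp
  define p where "p = (LEAST p. c / 2 \<le> f p)"
  have p: "c / 2 \<le> f p" unfolding p_def using ex by (rule LeastI)
  have "p \<noteq> 0" using p r(1) by (cases "p = 0") (simp_all add: f_def)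
  then obtain p' where p': "p = Suc p'" by (cases p) auto
  have less: "f p' < c / 2" using not_less_Least[of p' "\<lambda>p. c / 2 \<le> f p"] p' unfolding p_def by auto
  have "\<bar>sin (real p * \<beta>)\<bar> \<le> \<bar>sin (real p' * \<beta>) * cos \<beta>\<bar> + \<bar>cos (real p' * \<beta>) * sin \<beta>\<bar>"
  proof -
    have "real p * \<beta> = real p' * \<beta> + \<beta>" unfolding p' by (simp add: distrib_right)
    thus ?thesis by (simp only: sin_add abs_triangle_ineq)
  qed
  also have "\<dots> \<le> \<bar>sin (real p' * \<beta>)\<bar> * 1 + 1 * \<bar>\<beta>\<bar>"
    unfolding abs_mult by (intro add_mono mult_mono abs_sin_x_le_abs_x) auto
  finally have "2 * r * \<bar>sin (real p * \<beta>)\<bar> \<le> 2 * r * (\<bar>sin (real p' * \<beta>)\<bar> + \<bar>\<beta>\<bar>)"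
    using r0 by (intro mult_left_mono) auto
  also have "\<dots> = f p' + 2 * r * \<bar>\<beta>\<bar>" by (simp add: f_def distrib_left)
  also have "\<dots> \<le> c" using less \<beta>(2) by simp
  finally show ?thesis using p unfolding f_def by blast
qed

text \<open>For large \<open>r\<close> the lower bound on \<open>\<Psi>\<close> says nothing about \<open>\<Psi> (r cos \<dots>)\<close> itself. But the difference of two
  terms of the sum at distance \<open>2m\<close> is \<open>2 r sin (\<alpha> m) sin (\<dots>)\<close>, and by Dirichlet's theorem \<open>m\<close> can be
  chosen such that the amplitude \<open>2 r |sin (\<alpha> m)|\<close> lies in the range where \<open>\<Psi>\<close> is quadratic.\<close>

lemma sum_gap_large_ge:
  fixes \<Psi> :: "real \<Rightarrow> real"
  assumes n: "n > 0" "\<not> n dvd 2 * k"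
    and low: "\<And>s. \<bar>s\<bar> \<le> c \<Longrightarrow> \<gamma> * s\<^sup>2 \<le> \<Psi> s" and sub: "\<And>a b. \<Psi> (a - b) \<le> 2 * \<Psi> a + 2 * \<Psi> b"
    and \<gamma>: "\<gamma> \<ge> 0" and c: "c > 0" and D: "D > 0"
    and good: "\<And>m. 1 \<le> m \<Longrightarrow> m \<le> D \<Longrightarrow> \<not> n dvd k * m"
    and r: "c \<le> r" "8 * pi * r \<le> c * real D"
  shows "\<gamma> * c\<^sup>2 * real n / 32 \<le> (\<Sum>j<n. \<Psi> (r * cos (2 * pi * real k / real n * real j - \<theta>)))"
proof -
  define \<alpha> where "\<alpha> = 2 * pi * real k / real n"
  \<comment> \<open>Some multiple q k / n with q <= D is within 1/D of an integer, and
    \<open>good\<close> prevents it from being one. The remaining angle \<beta> is therefore small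
    but nonzero.\<close>
  obtain h q where q: "0 < q" "q \<le> int D" "\<bar>of_int q * (real k / real n) - of_int h\<bar> < 1 / real D"
    using Dirichlet_approx[OF D, of "real k / real n"] by blast
  define \<beta> where "\<beta> = 2 * pi * (of_int q * (real k / real n) - of_int h)"
  have b0: "\<beta> \<noteq> 0"
  proof
    assume "\<beta> = 0"
    hence "of_int q * real k = of_int h * real n" using n unfolding \<beta>_def by (simp add: field_simps)
    hence "real_of_int (int k * int (nat q)) = of_int (int n * h)" using q(1) by (simp add: mult_ac)
    hence "int (k * nat q) = int n * h" by (simp only: of_int_eq_iff of_nat_mult)
    hence "n dvd k * nat q" by (metis dvd_triv_left int_dvd_int_iff)
    moreover have "1 \<le> nat q" "nat q \<le> D" using q by auto
    ultimately show False using good by blast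
  qed
  have "\<bar>\<beta>\<bar> \<le> 2 * pi * (1 / real D)"
    unfolding \<beta>_def abs_mult using q(3) by (intro mult_mono) auto
  hence "4 * r * \<bar>\<beta>\<bar> \<le> 4 * r * (2 * pi * (1 / real D))" using c r by (intro mult_left_mono) auto
  also have "\<dots> \<le> c" using r(2) D by (simp add: field_simps)
  finally obtain p :: nat where p: "c / 2 \<le> 2 * r * \<bar>sin (real p * \<beta>)\<bar>" "2 * r * \<bar>sin (real p * \<beta>)\<bar> \<le> c"
    using exists_multiple_sin_between[OF b0 _ c r(1)] by blast
  \<comment> \<open>Modulo 2 pi the angle \<alpha> m equals p \<beta>, so m realises the amplitude
    between c/2 and c.\<close>
  define m where "m = p * nat q"
  have "\<alpha> * real m = real p * \<beta> + 2 * pi * of_int (int p * h)"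
    using q(1) n(1) unfolding \<alpha>_def m_def \<beta>_def by (simp add: field_simps)
  hence "cis (\<alpha> * real m) = cis (real p * \<beta>)"
    by (simp only: cis_mult[symmetric] cis_2pi_int_mult mult_1_right)
  hence sin_m: "sin (\<alpha> * real m) = sin (real p * \<beta>)" by (metis cis.sel(2))
  define s where "s = 2 * r * sin (\<alpha> * real m)"
  have s: "c / 2 \<le> \<bar>s\<bar>" "\<bar>s\<bar> \<le> c" using p c r unfolding s_def sin_m by (simp_all add: abs_mult)
  \<comment> \<open>From here on \<open>h\<close> is the summand, no longer the integer from
    Dirichlet's theorem. Its period n makes the sum invariant under the shift by 2m.\<close>
  define h where "h j = \<Psi> (r * cos (\<alpha> * real j - \<theta>))" for j :: nat
  have per: "h (j + n) = h j" for j
  proof -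
    have "\<alpha> * real (j + n) - \<theta> = (\<alpha> * real j - \<theta>) + 2 * pi * of_int (int k)"
      using n(1) unfolding \<alpha>_def by (simp add: field_simps)
    hence "cis (\<alpha> * real (j + n) - \<theta>) = cis (\<alpha> * real j - \<theta>)"
      by (simp only: cis_mult[symmetric] cis_2pi_int_mult mult_1_right)
    hence "cos (\<alpha> * real (j + n) - \<theta>) = cos (\<alpha> * real j - \<theta>)" by (metis cis.sel(1))
    thus ?thesis by (simp add: h_def)
  qed
  have step: "\<gamma> * (s * sin (\<alpha> * real j - (\<theta> - \<alpha> * real m)))\<^sup>2 \<le> 2 * h j + 2 * h (j + 2 * m)" for j
  proof -
    have "\<bar>s\<bar> * \<bar>sin (\<alpha> * real j - (\<theta> - \<alpha> * real m))\<bar> \<le> \<bar>s\<bar> * 1" by (intro mult_left_mono) auto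
    hence "\<bar>s * sin (\<alpha> * real j - (\<theta> - \<alpha> * real m))\<bar> \<le> c" using s by (simp add: abs_mult)
    hence "\<gamma> * (s * sin (\<alpha> * real j - (\<theta> - \<alpha> * real m)))\<^sup>2 \<le> \<Psi> (s * sin (\<alpha> * real j - (\<theta> - \<alpha> * real m)))"
      by (rule low)
    also have eq: "\<Psi> (s * sin (\<alpha> * real j - (\<theta> - \<alpha> * real m)))
        = \<Psi> (r * cos (\<alpha> * real j - \<theta>) - r * cos (\<alpha> * real (j + 2 * m) - \<theta>))"
    proof -
      have "cos (\<alpha> * real j - \<theta>) - cos (\<alpha> * real (j + 2 * m) - \<theta>)
        = 2 * sin (((\<alpha> * real j - \<theta>) + (\<alpha> * real (j + 2 * m) - \<theta>)) / 2)
            * sin (((\<alpha> * real (j + 2 * m) - \<theta>) - (\<alpha> * real j - \<theta>)) / 2)"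
        by (rule cos_diff_cos)
      also have "((\<alpha> * real j - \<theta>) + (\<alpha> * real (j + 2 * m) - \<theta>)) / 2 = \<alpha> * real j - (\<theta> - \<alpha> * real m)"
        by (simp add: field_simps)
      also have "((\<alpha> * real (j + 2 * m) - \<theta>) - (\<alpha> * real j - \<theta>)) / 2 = \<alpha> * real m"
        by (simp add: field_simps)
      finally show ?thesis unfolding s_def right_diff_distrib[symmetric] by (simp add: mult_ac)
    qed
    also have "\<dots> \<le> 2 * h j + 2 * h (j + 2 * m)" unfolding h_def by (rule sub)
    finally show ?thesis .
  qed
  \<comment> \<open>With |s| >= c/2 and mean square 1/2 of the sine, the left side is \<gamma> c^2 n
    / 8. The right side counts the sum four times, whence the 32.\<close>
  have "(c / 2)\<^sup>2 \<le> s\<^sup>2" using s c by (metis abs_le_square_iff abs_of_pos half_gt_zero)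
  hence "\<gamma> * (c / 2)\<^sup>2 * (real n / 2) \<le> \<gamma> * s\<^sup>2 * (real n / 2)"
    using \<gamma> by (intro mult_right_mono mult_left_mono) auto
  also have "\<dots> = (\<Sum>j<n. \<gamma> * (s * sin (\<alpha> * real j - (\<theta> - \<alpha> * real m)))\<^sup>2)"
    unfolding power_mult_distrib sum_distrib_left[symmetric] sum_sin_sq_roots[OF n, folded \<alpha>_def] by simp
  also have "\<dots> \<le> (\<Sum>j<n. 2 * h j + 2 * h (j + 2 * m))" by (intro sum_mono step)
  also have "\<dots> = 4 * (\<Sum>j<n. h j)"
    by (simp add: sum.distrib sum_distrib_left[symmetric] sum_periodic_shift[of h, OF per])
  finally show ?thesis unfolding h_def \<alpha>_def by (simp add: power2_eq_square)
qed

section \<open>Counting the indices of small order\<close>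

lemma card_dvd_mult_le:
  assumes "n > 0" "m > 0"
  shows "card {k. k < n \<and> n dvd k * m} \<le> m"
proof -
  \<comment> \<open>If n divides k m, then k is recovered from the quotient k m / n, which is below
    m because k < n.\<close>
  have "inj_on (\<lambda>k. k * m div n) {k. k < n \<and> n dvd k * m}"
    using assms by (auto simp: inj_on_def dvd_div_eq_iff)
  moreover have "(\<lambda>k. k * m div n) ` {k. k < n \<and> n dvd k * m} \<subseteq> {..<m}"
    using assms by (auto simp: div_less_iff_less_mult mult.commute)
  ultimately have "card {k. k < n \<and> n dvd k * m} \<le> card {..<m}"
    by (intro card_inj_on_le) auto
  thus ?thesis by simp
qed

text \<open>There are D choices of m with at most m <= D solutions each. For D about n^(1/4) this
  leaves at most n^(1/2) exceptional indices.\<close>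

lemma card_small_order_le:
  assumes "n > 0"
  shows "card {k. k < n \<and> (\<exists>m. 1 \<le> m \<and> m \<le> D \<and> n dvd k * m)} \<le> D\<^sup>2"
proof -
  have "{k. k < n \<and> (\<exists>m. 1 \<le> m \<and> m \<le> D \<and> n dvd k * m)} = (\<Union>m\<in>{1..D}. {k. k < n \<and> n dvd k * m})"
    by auto
  also have "card \<dots> \<le> (\<Sum>m\<in>{1..D}. card {k. k < n \<and> n dvd k * m})"
    by (intro card_UN_le) simp
  also have "\<dots> \<le> (\<Sum>m\<in>{1..D}. D)"
    using card_dvd_mult_le[OF assms] by (intro sum_mono) (metis atLeastAtMost_iff le_trans less_eq_Suc_le One_nat_def)
  finally show ?thesis by (simp add: power2_eq_square)
qed

section \<open>Small ball bounds for a single eigenvalue\<close>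

lemma polar_sum:
  fixes u v :: real
  obtains r \<theta> where "r = sqrt (u\<^sup>2 + v\<^sup>2)" "\<And>x. u * cos x + v * sin x = r * cos (x - \<theta>)"
proof
  let ?z = "Complex u v"
  have "rcis (cmod ?z) (Arg ?z) = ?z" by (rule rcis_cmod_Arg)
  hence "u = cmod ?z * cos (Arg ?z)" "v = cmod ?z * sin (Arg ?z)"
    by (metis Re_rcis complex.sel(1), metis Im_rcis complex.sel(2))
  hence "u * cos x + v * sin x = cmod ?z * cos (Arg ?z) * cos x + cmod ?z * sin (Arg ?z) * sin x" for x
    by simp
  thus "u * cos x + v * sin x = sqrt (u\<^sup>2 + v\<^sup>2) * cos (x - Arg ?z)" for x
    unfolding cos_diff by (simp only: complex_norm) (simp add: algebra_simps)
qed simp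

text \<open>Beyond radius L the trivial bound 1 on a characteristic function is covered by the
  growing weight of \<open>small_ball_le\<close> with \<eta> = exp(-L^2/4).\<close>

lemma exp_tail_weight_ge_1:
  fixes L g h :: real
  assumes "L\<^sup>2 \<le> g\<^sup>2 + h\<^sup>2"
  shows "1 \<le> exp (- L\<^sup>2 / 4) * (exp (g\<^sup>2 / 4) * exp (h\<^sup>2 / 4))"
  using assms unfolding exp_add[symmetric] one_le_exp_iff by (simp add: field_simps)

lemma (in prob_space) cmod_expectation_iexp_le_1: "cmod (\<integral>\<omega>. iexp (f \<omega>) \<partial>M) \<le> 1"
proof -
  have "cmod (\<integral>\<omega>. iexp (f \<omega>) \<partial>M) \<le> (\<integral>\<omega>. cmod (iexp (f \<omega>)) \<partial>M)" by (rule integral_norm_bound)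
  thus ?thesis using prob_space by simp
qed

text \<open>Condition (H) is kept only in the form \<open>gap\<close>; the theorem instantiates
  \<gamma> = q^2/16 and c = 1/(2K).\<close>

locale circulant_iid = prob_space M for M :: "'w measure" +
  fixes \<xi> :: "nat \<Rightarrow> 'w \<Rightarrow> real" and \<gamma> c :: real
  assumes rv: "\<And>i. \<xi> i \<in> borel_measurable M"
    and indep: "indep_vars (\<lambda>_. borel) \<xi> UNIV"
    and ident: "\<And>i. distr M borel (\<xi> i) = distr M borel (\<xi> 0)"
    and \<gamma>: "\<gamma> > 0" and c: "c > 0"
    and gap: "\<And>s. \<bar>s\<bar> \<le> c \<Longrightarrow> \<gamma> * s\<^sup>2 \<le> char_gap (distr M borel (\<xi> 0)) s"
begin

abbreviation \<mu> :: "real measure" where "\<mu> \<equiv> distr M borel (\<xi> 0)"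

abbreviation eig :: "nat \<Rightarrow> nat \<Rightarrow> 'w \<Rightarrow> complex" where
  "eig n k \<omega> \<equiv> circ_eig n (\<lambda>l. \<xi> l \<omega>) k"

lemma real_distribution_\<mu>: "real_distribution \<mu>"
  using rv by (rule real_distribution_distr)

lemma eig_measurable [measurable]: "eig n k \<in> borel_measurable M"
  by (rule borel_measurable_circ_eig[OF rv])

lemma Re_eig: "Re (eig n k \<omega>) = (\<Sum>j<n. \<xi> j \<omega> * cos (2 * pi * real k / real n * real j))"
  and Im_eig: "Im (eig n k \<omega>) = (\<Sum>j<n. \<xi> j \<omega> * sin (2 * pi * real k / real n * real j))"
  by (simp_all add: circ_eig_def)

text \<open>A combination of real and imaginary part is linear in the independent variables. Its
  characteristic function factors, and each factor is at most exp(-gap/2).\<close>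

lemma cmod_char_eig_le:
  fixes k n :: nat
  defines "\<alpha> \<equiv> 2 * pi * real k / real n"
  shows "cmod (\<integral>\<omega>. iexp (u * Re (eig n k \<omega>) + v * Im (eig n k \<omega>)) \<partial>M)
       \<le> exp (- (\<Sum>j<n. char_gap \<mu> (u * cos (\<alpha> * real j) + v * sin (\<alpha> * real j))) / 2)"
proof -
  interpret \<mu>: real_distribution \<mu> by (rule real_distribution_\<mu>)
  define s where "s j = u * cos (\<alpha> * real j) + v * sin (\<alpha> * real j)" for j :: nat
  have "(\<integral>\<omega>. iexp (u * Re (eig n k \<omega>) + v * Im (eig n k \<omega>)) \<partial>M)
      = (\<integral>\<omega>. (\<Prod>j<n. iexp (s j * \<xi> j \<omega>)) \<partial>M)"
  proof -
    have "u * Re (eig n k \<omega>) + v * Im (eig n k \<omega>) = (\<Sum>j<n. s j * \<xi> j \<omega>)" for \<omega>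
      unfolding Re_eig Im_eig \<alpha>_def[symmetric] s_def sum_distrib_left sum.distrib[symmetric]
      by (intro sum.cong refl) (simp add: algebra_simps)
    thus ?thesis by (simp only: of_real_sum sum_distrib_left exp_sum[OF finite_lessThan])
  qed
  also have "\<dots> = (\<Prod>j<n. \<integral>\<omega>. iexp (s j * \<xi> j \<omega>) \<partial>M)"
  proof (rule indep_vars_lebesgue_integral)
    show "indep_vars (\<lambda>_. borel) (\<lambda>j \<omega>. iexp (s j * \<xi> j \<omega>)) {..<n}"
      by (rule indep_vars_compose2[OF indep_vars_subset[OF indep]]) auto
    show "integrable M (\<lambda>\<omega>. iexp (s j * \<xi> j \<omega>))" for j
      using rv[of j] by (intro integrable_iexp) auto
  qed simp
  also have "\<dots> = (\<Prod>j<n. char \<mu> (s j))"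
  proof (intro prod.cong refl)
    fix j
    have "(\<integral>\<omega>. iexp (s j * \<xi> j \<omega>) \<partial>M) = char (distr M borel (\<xi> j)) (s j)"
      unfolding char_def using rv[of j] by (subst integral_distr) auto
    thus "(\<integral>\<omega>. iexp (s j * \<xi> j \<omega>) \<partial>M) = char \<mu> (s j)" by (simp only: ident[of j])
  qed
  finally have "cmod (\<integral>\<omega>. iexp (u * Re (eig n k \<omega>) + v * Im (eig n k \<omega>)) \<partial>M) = (\<Prod>j<n. cmod (char \<mu> (s j)))"
    by (simp only: prod_norm)
  also have "\<dots> \<le> (\<Prod>j<n. exp (- (char_gap \<mu> (s j) / 2)))"
    by (intro prod_mono conjI norm_ge_zero \<mu>.cmod_char_le_exp_gap)
  also have "\<dots> = exp (- (\<Sum>j<n. char_gap \<mu> (s j)) / 2)"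
    by (simp add: exp_sum[symmetric] sum_negf sum_divide_distrib)
  finally show ?thesis unfolding s_def .
qed

lemma prob_eig_le:
  assumes t: "t > 0" and ab: "a \<ge> 0" "b \<ge> 0" "\<delta> \<ge> 0" "\<eta> \<ge> 0"
    and bound: "\<And>g h. cmod (\<integral>\<omega>. iexp (g / t * Re (eig n k \<omega>) + h / t * Im (eig n k \<omega>)) \<partial>M)
        \<le> exp (- a * g\<^sup>2) * exp (- b * h\<^sup>2) + \<delta> + \<eta> * (exp (g\<^sup>2 / 4) * exp (h\<^sup>2 / 4))"
  shows "prob {\<omega> \<in> space M. cmod (eig n k \<omega>) \<le> t}
      \<le> exp (1 / 2) * (1 / (sqrt (1 + 2 * a) * sqrt (1 + 2 * b)) + \<delta> + 2 * \<eta>)"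
proof -
  have "cmod z \<le> t \<longleftrightarrow> (Re z)\<^sup>2 + (Im z)\<^sup>2 \<le> t\<^sup>2" for z
    using t abs_le_square_iff[of "cmod z" t] by (simp add: cmod_power2)
  thus ?thesis using small_ball_le[OF _ _ t ab bound] by simp
qed

text \<open>Let r be the radius of the frequency (g, h)/t. For r <= c the quadratic bound gives
  Gaussian decay. If the root of unity has order above D, as in the second estimate,
  \<open>sum_gap_large_ge\<close> handles c <= r <= c D / (8 pi). All larger radii fall to the
  trivial bound and the growing weight; the first estimate resorts to this from c on.\<close>

lemma prob_eig_complex_le:
  assumes n: "n > 0" "\<not> n dvd 2 * k" and t: "t > 0"
  shows "prob {\<omega> \<in> space M. cmod (eig n k \<omega>) \<le> t}
      \<le> exp (1 / 2) * (2 * t\<^sup>2 / (\<gamma> * real n) + 2 * exp (- (t * c)\<^sup>2 / 4))"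
    and "D > 0 \<Longrightarrow> (\<And>m. 1 \<le> m \<Longrightarrow> m \<le> D \<Longrightarrow> \<not> n dvd k * m) \<Longrightarrow>
      prob {\<omega> \<in> space M. cmod (eig n k \<omega>) \<le> t}
      \<le> exp (1 / 2) * (2 * t\<^sup>2 / (\<gamma> * real n) + exp (- (\<gamma> * c\<^sup>2 * real n / 64))
           + 2 * exp (- (t * (c * real D / (8 * pi)))\<^sup>2 / 4))"
proof -
  interpret \<mu>: real_distribution \<mu> by (rule real_distribution_\<mu>)
  \<comment> \<open>Half of the lower bound \<gamma> r^2 n / 2 is a (g^2 + h^2), because r^2 = (g^2
    + h^2)/t^2.\<close>
  define a where "a = \<gamma> * real n / (4 * t\<^sup>2)"
  have a: "a > 0" using \<gamma> n t by (simp add: a_def)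
  have inv: "1 / (sqrt (1 + 2 * a) * sqrt (1 + 2 * a)) \<le> 2 * t\<^sup>2 / (\<gamma> * real n)"
  proof -
    have "1 / (sqrt (1 + 2 * a) * sqrt (1 + 2 * a)) = 1 / (1 + 2 * a)" using a by simp
    also have "\<dots> \<le> 1 / (2 * a)" using a by (intro divide_left_mono) auto
    also have "\<dots> = 2 * t\<^sup>2 / (\<gamma> * real n)" using \<gamma> n t by (simp add: a_def field_simps)
    finally show ?thesis .
  qed
  let ?ch = "\<lambda>g h. cmod (\<integral>\<omega>. iexp (g / t * Re (eig n k \<omega>) + h / t * Im (eig n k \<omega>)) \<partial>M)"
  have main: "\<exists>r\<ge>0. g\<^sup>2 + h\<^sup>2 = (t * r)\<^sup>2 \<and> (r \<le> c \<longrightarrow> ?ch g h \<le> exp (- a * g\<^sup>2) * exp (- a * h\<^sup>2))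
     \<and> (\<forall>D>0. (\<forall>m. 1 \<le> m \<and> m \<le> D \<longrightarrow> \<not> n dvd k * m) \<longrightarrow> c \<le> r \<longrightarrow> 8 * pi * r \<le> c * real D \<longrightarrow>
         ?ch g h \<le> exp (- (\<gamma> * c\<^sup>2 * real n / 64)))" for g h
  proof -
    obtain r \<theta> where r: "r = sqrt ((g / t)\<^sup>2 + (h / t)\<^sup>2)"
      and pol: "\<And>x. g / t * cos x + h / t * sin x = r * cos (x - \<theta>)" by (rule polar_sum) blast
    let ?S = "\<Sum>j<n. char_gap \<mu> (r * cos (2 * pi * real k / real n * real j - \<theta>))"
    have r0: "r \<ge> 0" unfolding r by simp
    have r2: "g\<^sup>2 + h\<^sup>2 = (t * r)\<^sup>2"
      unfolding r using t by (simp add: power_mult_distrib power_divide field_simps)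
    have ch: "?ch g h \<le> exp (- ?S / 2)" using cmod_char_eig_le[of "g / t" n k "h / t"] unfolding pol .
    have "?ch g h \<le> exp (- a * g\<^sup>2) * exp (- a * h\<^sup>2)" if "r \<le> c"
    proof -
      have "\<gamma> * r\<^sup>2 * real n / 2 \<le> ?S" using that r0 by (intro sum_gap_small_ge[OF n gap]) auto
      moreover have "a * g\<^sup>2 + a * h\<^sup>2 = \<gamma> * r\<^sup>2 * real n / 4"
        unfolding distrib_left[symmetric] r2 a_def using t by (simp add: power_mult_distrib field_simps)
      ultimately have "- ?S / 2 \<le> - a * g\<^sup>2 + - a * h\<^sup>2" by linarith
      hence "exp (- ?S / 2) \<le> exp (- a * g\<^sup>2) * exp (- a * h\<^sup>2)"
        unfolding exp_add[symmetric] by (simp only: exp_le_cancel_iff)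
      thus ?thesis using ch by linarith
    qed
    moreover have "?ch g h \<le> exp (- (\<gamma> * c\<^sup>2 * real n / 64))"
      if "D > 0" "\<forall>m. 1 \<le> m \<and> m \<le> D \<longrightarrow> \<not> n dvd k * m" "c \<le> r" "8 * pi * r \<le> c * real D" for D
    proof -
      have "\<gamma> * c\<^sup>2 * real n / 32 \<le> ?S"
        using that \<gamma> c by (intro sum_gap_large_ge[OF n gap \<mu>.char_gap_diff_le, where D = D]) auto
      hence "- ?S / 2 \<le> - (\<gamma> * c\<^sup>2 * real n / 64)" by linarith
      hence "exp (- ?S / 2) \<le> exp (- (\<gamma> * c\<^sup>2 * real n / 64))" by (simp only: exp_le_cancel_iff)
      thus ?thesis using ch by linarith
    qed
    ultimately show ?thesis using r0 r2 by blast
  qed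
  have big: "1 \<le> exp (- (t * R)\<^sup>2 / 4) * (exp (g\<^sup>2 / 4) * exp (h\<^sup>2 / 4))"
    if "g\<^sup>2 + h\<^sup>2 = (t * r)\<^sup>2" "0 \<le> R" "R \<le> r" for g h r R
    using that t by (intro exp_tail_weight_ge_1) (auto intro!: power_mono mult_left_mono)
  show "prob {\<omega> \<in> space M. cmod (eig n k \<omega>) \<le> t}
      \<le> exp (1 / 2) * (2 * t\<^sup>2 / (\<gamma> * real n) + 2 * exp (- (t * c)\<^sup>2 / 4))"
  proof -
    have "prob {\<omega> \<in> space M. cmod (eig n k \<omega>) \<le> t}
      \<le> exp (1 / 2) * (1 / (sqrt (1 + 2 * a) * sqrt (1 + 2 * a)) + 0 + 2 * exp (- (t * c)\<^sup>2 / 4))"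
    proof (rule prob_eig_le[OF t])
      fix g h
      obtain r where r: "g\<^sup>2 + h\<^sup>2 = (t * r)\<^sup>2" "r \<le> c \<longrightarrow> ?ch g h \<le> exp (- a * g\<^sup>2) * exp (- a * h\<^sup>2)"
        using main by blast
      have nn: "0 \<le> exp (- a * g\<^sup>2) * exp (- a * h\<^sup>2)" "0 \<le> exp (- (t * c)\<^sup>2 / 4) * (exp (g\<^sup>2 / 4) * exp (h\<^sup>2 / 4))"
        by simp_all
      show "?ch g h \<le> exp (- a * g\<^sup>2) * exp (- a * h\<^sup>2) + 0 + exp (- (t * c)\<^sup>2 / 4) * (exp (g\<^sup>2 / 4) * exp (h\<^sup>2 / 4))"
      proof (cases "r \<le> c")
        case True
        thus ?thesis using r(2) nn by linarith
      next
        case False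
        hence "1 \<le> exp (- (t * c)\<^sup>2 / 4) * (exp (g\<^sup>2 / 4) * exp (h\<^sup>2 / 4))" using c by (intro big[OF r(1)]) auto
        thus ?thesis using cmod_expectation_iexp_le_1[of "\<lambda>\<omega>. g / t * Re (eig n k \<omega>) + h / t * Im (eig n k \<omega>)"] nn by linarith
      qed
    qed (use a in auto)
    also have "\<dots> \<le> exp (1 / 2) * (2 * t\<^sup>2 / (\<gamma> * real n) + 2 * exp (- (t * c)\<^sup>2 / 4))"
      using inv by (intro mult_left_mono) auto
    finally show ?thesis .
  qed
  assume D: "D > 0" "\<And>m. 1 \<le> m \<Longrightarrow> m \<le> D \<Longrightarrow> \<not> n dvd k * m"
  let ?R = "c * real D / (8 * pi)"
  show "prob {\<omega> \<in> space M. cmod (eig n k \<omega>) \<le> t}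
      \<le> exp (1 / 2) * (2 * t\<^sup>2 / (\<gamma> * real n) + exp (- (\<gamma> * c\<^sup>2 * real n / 64))
           + 2 * exp (- (t * ?R)\<^sup>2 / 4))"
  proof -
    have "prob {\<omega> \<in> space M. cmod (eig n k \<omega>) \<le> t}
      \<le> exp (1 / 2) * (1 / (sqrt (1 + 2 * a) * sqrt (1 + 2 * a)) + exp (- (\<gamma> * c\<^sup>2 * real n / 64))
           + 2 * exp (- (t * ?R)\<^sup>2 / 4))"
    proof (rule prob_eig_le[OF t])
      fix g h
      obtain r where r: "g\<^sup>2 + h\<^sup>2 = (t * r)\<^sup>2" "r \<le> c \<longrightarrow> ?ch g h \<le> exp (- a * g\<^sup>2) * exp (- a * h\<^sup>2)"
        "c \<le> r \<longrightarrow> 8 * pi * r \<le> c * real D \<longrightarrow> ?ch g h \<le> exp (- (\<gamma> * c\<^sup>2 * real n / 64))"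
      proof -
        from main[of g h] obtain r where r: "g\<^sup>2 + h\<^sup>2 = (t * r)\<^sup>2" "r \<le> c \<longrightarrow> ?ch g h \<le> exp (- a * g\<^sup>2) * exp (- a * h\<^sup>2)"
          "\<forall>D>0. (\<forall>m. 1 \<le> m \<and> m \<le> D \<longrightarrow> \<not> n dvd k * m) \<longrightarrow> c \<le> r \<longrightarrow> 8 * pi * r \<le> c * real D \<longrightarrow>
             ?ch g h \<le> exp (- (\<gamma> * c\<^sup>2 * real n / 64))" by blast
        from r(3)[rule_format, OF D(1)] D(2) show ?thesis by (intro that[OF r(1,2)]) auto
      qed
      have nn: "0 \<le> exp (- a * g\<^sup>2) * exp (- a * h\<^sup>2)" "0 \<le> exp (- (t * ?R)\<^sup>2 / 4) * (exp (g\<^sup>2 / 4) * exp (h\<^sup>2 / 4))"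
        "0 \<le> exp (- (\<gamma> * c\<^sup>2 * real n / 64))"
        by simp_all
      have "?R \<le> r \<longleftrightarrow> c * real D \<le> 8 * pi * r" by (simp add: field_simps)
      then consider "r \<le> c" | "c \<le> r" "8 * pi * r \<le> c * real D" | "?R \<le> r" by linarith
      thus "?ch g h \<le> exp (- a * g\<^sup>2) * exp (- a * h\<^sup>2) + exp (- (\<gamma> * c\<^sup>2 * real n / 64))
          + exp (- (t * ?R)\<^sup>2 / 4) * (exp (g\<^sup>2 / 4) * exp (h\<^sup>2 / 4))"
      proof cases
        case 3
        hence "1 \<le> exp (- (t * ?R)\<^sup>2 / 4) * (exp (g\<^sup>2 / 4) * exp (h\<^sup>2 / 4))" using c by (intro big[OF r(1)]) auto
        thus ?thesis using cmod_expectation_iexp_le_1[of "\<lambda>\<omega>. g / t * Re (eig n k \<omega>) + h / t * Im (eig n k \<omega>)"] nn by linarith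
      qed (use r nn in linarith)+
    qed (use a in auto)
    also have "\<dots> \<le> exp (1 / 2) * (2 * t\<^sup>2 / (\<gamma> * real n) + exp (- (\<gamma> * c\<^sup>2 * real n / 64))
           + 2 * exp (- (t * ?R)\<^sup>2 / 4))"
      using inv by (intro mult_left_mono) auto
    finally show ?thesis .
  qed
qed

text \<open>If n divides 2k, every exponential is 1 or -1 and the eigenvalue is real. Its
  characteristic function decays only in g, so \<open>small_ball_le\<close> is used with b = 0 and
  the result is linear instead of quadratic in t.\<close>

lemma prob_eig_real_le:
  assumes n: "n > 0" "n dvd 2 * k" and t: "t > 0"
  shows "prob {\<omega> \<in> space M. cmod (eig n k \<omega>) \<le> t}
      \<le> exp (1 / 2) * (t / sqrt (\<gamma> * real n) + 2 * exp (- (t * c)\<^sup>2 / 4))"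
proof -
  \<comment> \<open>All cosines have modulus 1 instead of mean square 1/2, which doubles the value
    of the complex case.\<close>
  define a where "a = \<gamma> * real n / (2 * t\<^sup>2)"
  have a: "a > 0" using \<gamma> n t by (simp add: a_def)
  obtain z where z: "2 * k = n * z" using n(2) by blast
  have \<alpha>: "2 * pi * real k / real n * real j = pi * of_int (int (z * j))" for j
  proof -
    have "2 * real k = real n * real z" using z by (metis of_nat_mult of_nat_numeral)
    thus ?thesis using n(1) by (simp add: field_simps)
  qed
  have sin0: "sin (2 * pi * real k / real n * real j) = 0" for j
    unfolding \<alpha> by (simp only: sin_npi_int)
  have cos1: "\<bar>cos (2 * pi * real k / real n * real j)\<bar> = 1" for j
    using sin_cos_squared_add[of "2 * pi * real k / real n * real j"] unfolding sin0
    by (simp add: abs_square_eq_1[symmetric] power2_eq_1_iff)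
  have "prob {\<omega> \<in> space M. cmod (eig n k \<omega>) \<le> t}
      \<le> exp (1 / 2) * (1 / (sqrt (1 + 2 * a) * sqrt (1 + 2 * 0)) + 0 + 2 * exp (- (t * c)\<^sup>2 / 4))"
  proof (rule prob_eig_le[OF t])
    fix g h
    let ?ch = "cmod (\<integral>\<omega>. iexp (g / t * Re (eig n k \<omega>) + h / t * Im (eig n k \<omega>)) \<partial>M)"
    have nn: "0 \<le> exp (- a * g\<^sup>2)" "0 \<le> exp (- (t * c)\<^sup>2 / 4) * (exp (g\<^sup>2 / 4) * exp (h\<^sup>2 / 4))"
      by simp_all
    have "?ch \<le> exp (- a * g\<^sup>2) + exp (- (t * c)\<^sup>2 / 4) * (exp (g\<^sup>2 / 4) * exp (h\<^sup>2 / 4))"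
    proof (cases "\<bar>g / t\<bar> \<le> c")
      case True
      have "\<gamma> * (g / t)\<^sup>2 \<le> char_gap \<mu> (g / t * cos (2 * pi * real k / real n * real j) + h / t * sin (2 * pi * real k / real n * real j))" for j
      proof -
        have "\<gamma> * (g / t * cos (2 * pi * real k / real n * real j))\<^sup>2 \<le> char_gap \<mu> (g / t * cos (2 * pi * real k / real n * real j))"
          using True cos1[of j] by (intro gap) (simp only: abs_mult mult_1_right)
        moreover have "(cos (2 * pi * real k / real n * real j))\<^sup>2 = 1"
          using cos1[of j] by (metis power2_abs power_one)
        ultimately show ?thesis unfolding sin0 power_mult_distrib by simp
      qed
      hence "(\<Sum>j<n. \<gamma> * (g / t)\<^sup>2) \<le> (\<Sum>j<n. char_gap \<mu> (g / t * cos (2 * pi * real k / real n * real j) + h / t * sin (2 * pi * real k / real n * real j)))"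
        (is "_ \<le> ?S") by (intro sum_mono)
      moreover have "(\<Sum>j<n. \<gamma> * (g / t)\<^sup>2) = 2 * (a * g\<^sup>2)"
        using t by (simp add: a_def power_divide field_simps)
      ultimately have "exp (- ?S / 2) \<le> exp (- a * g\<^sup>2)" by simp
      thus ?thesis using cmod_char_eig_le[of "g / t" n k "h / t"] nn by linarith
    next
      case False
      hence "t * c \<le> \<bar>g\<bar>" using t by (simp add: field_simps)
      hence "(t * c)\<^sup>2 \<le> \<bar>g\<bar>\<^sup>2" using t c by (intro power_mono) auto
      hence "(t * c)\<^sup>2 \<le> g\<^sup>2 + h\<^sup>2" using zero_le_power2[of h] power2_abs[of g] by linarith
      from exp_tail_weight_ge_1[OF this] show ?thesis
        using cmod_expectation_iexp_le_1[of "\<lambda>\<omega>. g / t * Re (eig n k \<omega>) + h / t * Im (eig n k \<omega>)"] nn by linarith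
    qed
    thus "?ch \<le> exp (- a * g\<^sup>2) * exp (- 0 * h\<^sup>2) + 0 + exp (- (t * c)\<^sup>2 / 4) * (exp (g\<^sup>2 / 4) * exp (h\<^sup>2 / 4))"
      by simp
  qed (use a in auto)
  also have "1 / (sqrt (1 + 2 * a) * sqrt (1 + 2 * 0)) \<le> t / sqrt (\<gamma> * real n)"
  proof -
    have "1 / (sqrt (1 + 2 * a) * sqrt (1 + 2 * 0)) = 1 / sqrt (1 + 2 * a)" by simp
    also have "\<dots> \<le> 1 / sqrt (2 * a)" using a by (intro divide_left_mono) auto
    also have "\<dots> = t / sqrt (\<gamma> * real n)" using t by (simp add: a_def real_sqrt_divide)
    finally show ?thesis .
  qed
  finally show ?thesis by simp
qed

end

section \<open>The extreme eigenvalues and the condition number\<close>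

lemma nat_floor_bounds:
  fixes x :: real
  assumes "1 \<le> x"
  shows "1 \<le> nat \<lfloor>x\<rfloor>" "real (nat \<lfloor>x\<rfloor>) \<le> x" "x / 2 \<le> real (nat \<lfloor>x\<rfloor>)"
proof -
  have f: "1 \<le> \<lfloor>x\<rfloor>" using assms by (simp add: le_floor_iff)
  have r: "real (nat \<lfloor>x\<rfloor>) = of_int \<lfloor>x\<rfloor>" using f by simp
  have "1 \<le> real_of_int \<lfloor>x\<rfloor>" using f by (metis of_int_1_le_iff)
  thus "1 \<le> nat \<lfloor>x\<rfloor>" "real (nat \<lfloor>x\<rfloor>) \<le> x" "x / 2 \<le> real (nat \<lfloor>x\<rfloor>)"
    unfolding r using f floor_correct[of x] by linarith+
qed

lemma exp_le_quadratic:
  fixes x :: real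
  shows "exp x \<le> 1 + x + x\<^sup>2 * exp \<bar>x\<bar>"
proof -
  obtain t where t: "\<bar>t\<bar> \<le> \<bar>x\<bar>" "exp x = (\<Sum>m<2. x ^ m / fact m) + exp t / fact 2 * x ^ 2"
    using Maclaurin_exp_le[of x 2] by blast
  have "exp t / 2 * x\<^sup>2 \<le> exp \<bar>x\<bar> * x\<^sup>2"
  proof (rule mult_right_mono)
    have "exp t \<le> exp \<bar>x\<bar>" using t(1) by simp
    thus "exp t / 2 \<le> exp \<bar>x\<bar>" using exp_gt_zero[of t] by linarith
  qed simp
  thus ?thesis using t(2) by (simp add: numeral_2_eq_2 mult.commute)
qed

section \<open>Chernoff bounds for all eigenvalues at once\<close>

context prob_space
begin

lemma chernoff_sum_ge:
  fixes Y :: "nat \<Rightarrow> 'a \<Rightarrow> real"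
  assumes indep: "indep_vars (\<lambda>_. borel) Y {..<n}" and u: "u > 0"
    and mgf: "\<And>j t. j < n \<Longrightarrow> \<bar>t\<bar> \<le> u \<Longrightarrow> integrable M (\<lambda>\<omega>. exp (t * Y j \<omega>)) \<and> expectation (\<lambda>\<omega>. exp (t * Y j \<omega>)) \<le> exp \<kappa>"
    and a: "\<And>j. \<bar>a j\<bar> \<le> 1"
  shows "prob {\<omega> \<in> space M. (\<Sum>j<n. Y j \<omega> * a j) \<ge> s} \<le> exp (real n * \<kappa> - u * s)"
proof -
  have mgf': "integrable M (\<lambda>\<omega>. exp (u * a j * Y j \<omega>))" "expectation (\<lambda>\<omega>. exp (u * a j * Y j \<omega>)) \<le> exp \<kappa>"
    if "j < n" for j
  proof -
    have "\<bar>u\<bar> * \<bar>a j\<bar> \<le> u * 1" using a u by (intro mult_mono) auto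
    hence "\<bar>u * a j\<bar> \<le> u" by (simp add: abs_mult)
    thus "integrable M (\<lambda>\<omega>. exp (u * a j * Y j \<omega>))" "expectation (\<lambda>\<omega>. exp (u * a j * Y j \<omega>)) \<le> exp \<kappa>"
      using mgf[OF that] by blast+
  qed
  have ind: "indep_vars (\<lambda>_. borel) (\<lambda>j \<omega>. exp (u * a j * Y j \<omega>)) {..<n}"
    by (rule indep_vars_compose2[OF indep]) auto
  have eq: "exp (u * (\<Sum>j<n. Y j \<omega> * a j)) = (\<Prod>j<n. exp (u * a j * Y j \<omega>))" for \<omega>
    by (simp add: exp_sum[symmetric] sum_distrib_left mult_ac)
  have int: "integrable M (\<lambda>\<omega>. exp (u * (\<Sum>j<n. Y j \<omega> * a j)))"
    unfolding eq using mgf' by (intro indep_vars_integrable ind) auto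
  hence sint: "set_integrable M (space M) (\<lambda>\<omega>. exp (u * (\<Sum>j<n. Y j \<omega> * a j)))"
    unfolding set_integrable_def by (subst Bochner_Integration.integrable_cong[OF refl]) auto
  have "prob {\<omega> \<in> space M. (\<Sum>j<n. Y j \<omega> * a j) \<ge> s}
      \<le> exp (- u * s) * (\<integral>\<omega>\<in>space M. exp (u * (\<Sum>j<n. Y j \<omega> * a j)) \<partial>M)"
    by (rule Chernoff_ineq_ge[OF u sint]) simp
  also have "(\<integral>\<omega>\<in>space M. exp (u * (\<Sum>j<n. Y j \<omega> * a j)) \<partial>M) = (\<Prod>j<n. expectation (\<lambda>\<omega>. exp (u * a j * Y j \<omega>)))"
    unfolding set_integral_space[OF int] unfolding eq using mgf' by (intro indep_vars_lebesgue_integral ind) auto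
  also have "exp (- u * s) * \<dots> \<le> exp (- u * s) * (\<Prod>j<n. exp \<kappa>)"
    using mgf' by (intro mult_left_mono prod_mono) (auto intro!: Bochner_Integration.integral_nonneg)
  also have "\<dots> = exp (real n * \<kappa> - u * s)"
    by (simp add: exp_of_nat_mult[symmetric] exp_add[symmetric])
  finally show ?thesis by simp
qed

text \<open>For each k four one-sided Chernoff events, for plus and minus the cosine and sine sums,
  control real and imaginary part by s; there are 4n of them. An exceptional set is produced so that
  it can be united with others later.\<close>

lemma circ_eig_max_tail:
  fixes Y :: "nat \<Rightarrow> 'a \<Rightarrow> real"
  assumes indep: "indep_vars (\<lambda>_. borel) Y {..<n}" and u: "u > 0"
    and mgf: "\<And>j t. j < n \<Longrightarrow> \<bar>t\<bar> \<le> u \<Longrightarrow> integrable M (\<lambda>\<omega>. exp (t * Y j \<omega>)) \<and> expectation (\<lambda>\<omega>. exp (t * Y j \<omega>)) \<le> exp \<kappa>"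
  shows "\<exists>E\<in>events. prob E \<le> 4 * real n * exp (real n * \<kappa> - u * s) \<and>
      (\<forall>\<omega>\<in>space M - E. \<forall>k<n. cmod (circ_eig n (\<lambda>l. Y l \<omega>) k) \<le> 2 * s)"
proof -
  let ?\<alpha> = "\<lambda>k. 2 * pi * real k / real n"
  have [measurable]: "Y j \<in> borel_measurable M" if "j < n" for j
    using indep that unfolding indep_vars_def by auto
  define F where "F a = {\<omega> \<in> space M. (\<Sum>j<n. Y j \<omega> * a j) \<ge> s}" for a :: "nat \<Rightarrow> real"
  have Fm: "F a \<in> events" for a unfolding F_def by measurable
  have Fp: "prob (F a) \<le> exp (real n * \<kappa> - u * s)" if "\<And>j. \<bar>a j\<bar> \<le> 1" for a
    unfolding F_def by (rule chernoff_sum_ge[OF indep u mgf that])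
  define G where "G k = (F (\<lambda>j. cos (?\<alpha> k * real j)) \<union> F (\<lambda>j. - cos (?\<alpha> k * real j)))
      \<union> (F (\<lambda>j. sin (?\<alpha> k * real j)) \<union> F (\<lambda>j. - sin (?\<alpha> k * real j)))" for k
  have Gm: "G k \<in> events" for k unfolding G_def using Fm by auto
  have Gp: "prob (G k) \<le> 4 * exp (real n * \<kappa> - u * s)" for k
  proof -
    have "prob (G k) \<le> (prob (F (\<lambda>j. cos (?\<alpha> k * real j))) + prob (F (\<lambda>j. - cos (?\<alpha> k * real j))))
        + (prob (F (\<lambda>j. sin (?\<alpha> k * real j))) + prob (F (\<lambda>j. - sin (?\<alpha> k * real j))))"
      unfolding G_def by (intro order_trans[OF measure_Un_le] add_mono measure_Un_le sets.Un Fm)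
    also have "\<dots> \<le> (exp (real n * \<kappa> - u * s) + exp (real n * \<kappa> - u * s))
        + (exp (real n * \<kappa> - u * s) + exp (real n * \<kappa> - u * s))"
      by (intro add_mono Fp) auto
    finally show ?thesis by simp
  qed
  let ?E = "\<Union>k<n. G k"
  show ?thesis
  proof (intro bexI[of _ ?E] conjI ballI allI impI)
    show "?E \<in> events" using Gm by auto
    have "prob ?E \<le> (\<Sum>k<n. prob (G k))" using Gm by (intro finite_measure_subadditive_finite) auto
    also have "\<dots> \<le> (\<Sum>k<n. 4 * exp (real n * \<kappa> - u * s))" by (intro sum_mono Gp)
    finally show "prob ?E \<le> 4 * real n * exp (real n * \<kappa> - u * s)" by simp
  next
    fix \<omega> k assume \<omega>: "\<omega> \<in> space M - ?E" and k: "k < n"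
    have neg: "(\<Sum>j<n. Y j \<omega> * - b j) = - (\<Sum>j<n. Y j \<omega> * b j)" for b
      by (simp add: sum_negf)
    have "\<omega> \<in> space M" "\<omega> \<notin> G k" using \<omega> k by auto
    hence "\<bar>\<Sum>j<n. Y j \<omega> * cos (?\<alpha> k * real j)\<bar> \<le> s" "\<bar>\<Sum>j<n. Y j \<omega> * sin (?\<alpha> k * real j)\<bar> \<le> s"
      unfolding G_def F_def Un_iff mem_Collect_eq neg by linarith+
    moreover have "cmod z \<le> \<bar>Re z\<bar> + \<bar>Im z\<bar>" for z by (rule cmod_le)
    from this[of "circ_eig n (\<lambda>l. Y l \<omega>) k"]
    have "cmod (circ_eig n (\<lambda>l. Y l \<omega>) k) \<le> \<bar>\<Sum>j<n. Y j \<omega> * cos (?\<alpha> k * real j)\<bar> + \<bar>\<Sum>j<n. Y j \<omega> * sin (?\<alpha> k * real j)\<bar>"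
      by (simp add: circ_eig_def)
    ultimately show "cmod (circ_eig n (\<lambda>l. Y l \<omega>) k) \<le> 2 * s" by linarith
  qed
qed

text \<open>Mean zero removes the linear Taylor term, and the remainder X^2 exp |t X| is dominated,
  uniformly in |t| <= a/4, by the integrable \<open>W\<close>.\<close>

lemma mgf_le_exp_square:
  fixes X :: "'a \<Rightarrow> real" and a :: real
  assumes [measurable]: "X \<in> borel_measurable M" and int: "integrable M X" "expectation X = 0"
    and a: "a > 0" and mgf: "\<And>t. \<bar>t\<bar> < a \<Longrightarrow> integrable M (\<lambda>\<omega>. exp (t * X \<omega>))"
  shows "\<exists>K\<ge>0. \<forall>t. \<bar>t\<bar> \<le> a / 4 \<longrightarrow> expectation (\<lambda>\<omega>. exp (t * X \<omega>)) \<le> exp (K * t\<^sup>2)"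
proof -
  \<comment> \<open>Up to constants, X^2 and exp |t X| each cost at most exp (b |X|). Their product
    exp (2 b |X|) is integrable because 2b = a/2 < a.\<close>
  define b where "b = a / 4"
  have b: "b > 0" using a by (simp add: b_def)
  define W where "W \<omega> = 2 / b\<^sup>2 * (exp (2 * b * X \<omega>) + exp (- 2 * b * X \<omega>))" for \<omega>
  have W: "integrable M W"
    unfolding W_def using mgf[of "2 * b"] mgf[of "- 2 * b"] a
    by (intro integrable_mult_right Bochner_Integration.integrable_add) (auto simp: b_def)
  have W0: "0 \<le> W \<omega>" for \<omega> by (simp add: W_def)
  have Wge: "(X \<omega>)\<^sup>2 * exp \<bar>t * X \<omega>\<bar> \<le> W \<omega>" if "\<bar>t\<bar> \<le> b" for t \<omega>
  proof -
    have "1 + b * \<bar>X \<omega>\<bar> + (b * \<bar>X \<omega>\<bar>)\<^sup>2 / 2 \<le> exp (b * \<bar>X \<omega>\<bar>)"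
      using b by (intro exp_lower_Taylor_quadratic) simp
    moreover have "0 \<le> b * \<bar>X \<omega>\<bar>" using b by simp
    ultimately have "(b * \<bar>X \<omega>\<bar>)\<^sup>2 / 2 \<le> exp (b * \<bar>X \<omega>\<bar>)" by linarith
    hence 1: "(X \<omega>)\<^sup>2 \<le> 2 / b\<^sup>2 * exp (b * \<bar>X \<omega>\<bar>)"
      using b by (simp add: power_mult_distrib field_simps)
    have 2: "exp \<bar>t * X \<omega>\<bar> \<le> exp (b * \<bar>X \<omega>\<bar>)"
      using that by (simp add: abs_mult mult_right_mono)
    have "(X \<omega>)\<^sup>2 * exp \<bar>t * X \<omega>\<bar> \<le> 2 / b\<^sup>2 * exp (b * \<bar>X \<omega>\<bar>) * exp (b * \<bar>X \<omega>\<bar>)"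
      by (intro mult_mono 1 2) auto
    also have "\<dots> = 2 / b\<^sup>2 * exp (2 * b * \<bar>X \<omega>\<bar>)" by (simp add: exp_add[symmetric])
    also have "\<dots> \<le> W \<omega>" unfolding W_def
      by (intro mult_left_mono) (cases "X \<omega> \<ge> 0", auto)
    finally show ?thesis .
  qed
  have "expectation (\<lambda>\<omega>. exp (t * X \<omega>)) \<le> exp (expectation W * t\<^sup>2)" if t: "\<bar>t\<bar> \<le> b" for t
  proof -
    have "expectation (\<lambda>\<omega>. exp (t * X \<omega>)) \<le> expectation (\<lambda>\<omega>. 1 + t * X \<omega> + t\<^sup>2 * W \<omega>)"
    proof (intro integral_mono Bochner_Integration.integrable_add integrable_mult_right int W mgf)
      show "\<bar>t\<bar> < a" using t a by (simp add: b_def)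
      fix \<omega>
      have "exp (t * X \<omega>) \<le> 1 + t * X \<omega> + t\<^sup>2 * ((X \<omega>)\<^sup>2 * exp \<bar>t * X \<omega>\<bar>)"
        using exp_le_quadratic[of "t * X \<omega>"] by (simp add: power_mult_distrib mult_ac)
      also have "\<dots> \<le> 1 + t * X \<omega> + t\<^sup>2 * W \<omega>"
        by (intro add_left_mono mult_left_mono Wge t) simp
      finally show "exp (t * X \<omega>) \<le> 1 + t * X \<omega> + t\<^sup>2 * W \<omega>" .
    qed simp
    also have "\<dots> = 1 + expectation W * t\<^sup>2" using int W prob_space by (simp add: mult.commute)
    also have "\<dots> \<le> exp (expectation W * t\<^sup>2)" by (rule exp_ge_add_one_self)
    finally show ?thesis .
  qed
  moreover have "0 \<le> expectation W" by (intro Bochner_Integration.integral_nonneg W0)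
  ultimately show ?thesis unfolding b_def by blast
qed

end

section \<open>The largest eigenvalue under the two moment assumptions\<close>

context circulant_iid
begin

lemma ident_integral:
  fixes f :: "real \<Rightarrow> real"
  assumes [measurable]: "f \<in> borel_measurable borel"
  shows "(\<integral>\<omega>. f (\<xi> j \<omega>) \<partial>M) = (\<integral>\<omega>. f (\<xi> 0 \<omega>) \<partial>M)"
    and "integrable M (\<lambda>\<omega>. f (\<xi> j \<omega>)) \<longleftrightarrow> integrable M (\<lambda>\<omega>. f (\<xi> 0 \<omega>))"
proof -
  have "(\<integral>\<omega>. f (\<xi> j \<omega>) \<partial>M) = (\<integral>x. f x \<partial>distr M borel (\<xi> j))" for j
    using rv by (subst integral_distr) auto
  thus "(\<integral>\<omega>. f (\<xi> j \<omega>) \<partial>M) = (\<integral>\<omega>. f (\<xi> 0 \<omega>) \<partial>M)"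
    by (simp only: ident[of j])
  have "integrable M (\<lambda>\<omega>. f (\<xi> j \<omega>)) \<longleftrightarrow> integrable (distr M borel (\<xi> j)) f" for j
    using rv by (subst integrable_distr_eq) auto
  thus "integrable M (\<lambda>\<omega>. f (\<xi> j \<omega>)) \<longleftrightarrow> integrable M (\<lambda>\<omega>. f (\<xi> 0 \<omega>))"
    by (simp only: ident[of j])
qed

lemma max_eig_subexponential:
  assumes int: "integrable M (\<xi> 0)" "expectation (\<xi> 0) = 0"
    and a: "a > 0" "\<And>t. \<bar>t\<bar> < a \<Longrightarrow> integrable M (\<lambda>\<omega>. exp (t * \<xi> 0 \<omega>))"
  shows "\<exists>B>0. \<forall>\<^sub>F n in sequentially. \<exists>E\<in>events. prob E \<le> 4 / real n \<and>
      (\<forall>\<omega>\<in>space M - E. \<forall>k<n. cmod (eig n k \<omega>) \<le> B * sqrt (real n * ln (real n)))"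
proof -
  obtain K where K: "K \<ge> 0" "\<And>t. \<bar>t\<bar> \<le> a / 4 \<Longrightarrow> expectation (\<lambda>\<omega>. exp (t * \<xi> 0 \<omega>)) \<le> exp (K * t\<^sup>2)"
    using mgf_le_exp_square[OF rv int a] by blast
  have "((\<lambda>n::nat. sqrt (ln (real n) / real n)) \<longlongrightarrow> 0) sequentially" by real_asymp
  hence "\<forall>\<^sub>F n in sequentially. sqrt (ln (real n) / real n) < a / 4"
    using a(1) by (intro order_tendstoD) auto
  hence "\<forall>\<^sub>F n in sequentially. \<exists>E\<in>events. prob E \<le> 4 / real n \<and>
      (\<forall>\<omega>\<in>space M - E. \<forall>k<n. cmod (eig n k \<omega>) \<le> 2 * (K + 2) * sqrt (real n * ln (real n)))"
    using eventually_ge_at_top[of 2]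
  proof eventually_elim
    fix n :: nat assume n: "sqrt (ln (real n) / real n) < a / 4" "2 \<le> n"
    \<comment> \<open>These choices give n K u^2 = K ln n and u s = (K + 2) ln n. The exponent is -2
      ln n, which turns the factor 4n of the union bound into 4/n.\<close>
    define u where "u = sqrt (ln (real n) / real n)"
    define s where "s = (K + 2) * sqrt (real n * ln (real n))"
    have ln: "ln (real n) > 0" using n by simp
    have u: "u > 0" "u \<le> a / 4" using n ln by (auto simp: u_def)
    have "\<exists>E\<in>events. prob E \<le> 4 * real n * exp (real n * (K * u\<^sup>2) - u * s) \<and>
      (\<forall>\<omega>\<in>space M - E. \<forall>k<n. cmod (circ_eig n (\<lambda>l. \<xi> l \<omega>) k) \<le> 2 * s)"
    proof (rule circ_eig_max_tail[OF _ u(1)])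
      show "indep_vars (\<lambda>_. borel) \<xi> {..<n}" using indep by (rule indep_vars_subset) simp
      fix j t assume t: "\<bar>t\<bar> \<le> u"
      have "integrable M (\<lambda>\<omega>. exp (t * \<xi> 0 \<omega>))" using t u a(1) by (intro a(2)) linarith
      moreover have "expectation (\<lambda>\<omega>. exp (t * \<xi> 0 \<omega>)) \<le> exp (K * u\<^sup>2)"
      proof -
        have "t\<^sup>2 \<le> u\<^sup>2" using t u by (metis abs_le_square_iff abs_of_pos)
        hence "exp (K * t\<^sup>2) \<le> exp (K * u\<^sup>2)" using K(1) by (simp add: mult_left_mono)
        thus ?thesis using K(2)[of t] t u by linarith
      qed
      ultimately show "integrable M (\<lambda>\<omega>. exp (t * \<xi> j \<omega>)) \<and> expectation (\<lambda>\<omega>. exp (t * \<xi> j \<omega>)) \<le> exp (K * u\<^sup>2)"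
        using ident_integral[of "\<lambda>x. exp (t * x)" j] by simp
    qed
    moreover have "real n * (K * u\<^sup>2) = K * ln (real n)" using ln n by (simp add: u_def)
    moreover have "u * s = (K + 2) * ln (real n)"
    proof -
      have "u * s = (K + 2) * (sqrt (ln (real n) / real n) * sqrt (real n * ln (real n)))"
        unfolding u_def s_def by (simp only: mult_ac)
      also have "sqrt (ln (real n) / real n) * sqrt (real n * ln (real n)) = sqrt ((ln (real n))\<^sup>2)"
        unfolding real_sqrt_mult[symmetric] using n by (simp add: power2_eq_square)
      finally show ?thesis using ln by simp
    qed
    moreover have "K * ln (real n) - (K + 2) * ln (real n) = ln (real n) * -2" by (simp add: algebra_simps)
    moreover have "4 * real n * exp (ln (real n) * -2) = 4 / real n"
    proof -
      have "exp (ln (real n) * -2) = 1 / (real n)\<^sup>2"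
        using n by (simp add: exp_minus exp_double inverse_eq_divide mult.commute[of _ 2])
      thus ?thesis using n by (simp add: power2_eq_square)
    qed
    ultimately show "\<exists>E\<in>events. prob E \<le> 4 / real n \<and>
      (\<forall>\<omega>\<in>space M - E. \<forall>k<n. cmod (eig n k \<omega>) \<le> 2 * (K + 2) * sqrt (real n * ln (real n)))"
      by (simp only: s_def mult.assoc)
  qed
  thus ?thesis using K(1) by (intro exI[of _ "2 * (K + 2)"]) auto
qed

text \<open>Truncate at Q = sqrt n. The truncated variables have exponential moments at scale 1/Q
  and obey Chernoff. The discarded parts satisfy |x - tr x| <= x^2/Q, so they add at most Q ln n
  unless the sum of squares reaches n ln n, an event of probability at most v / ln n by
  Markov.\<close>

lemma max_eig_second_moment:
  assumes int: "integrable M (\<xi> 0)" "expectation (\<xi> 0) = 0" and sq: "integrable M (\<lambda>\<omega>. (\<xi> 0 \<omega>)\<^sup>2)"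
    and n: "2 \<le> n"
  defines "v \<equiv> expectation (\<lambda>\<omega>. (\<xi> 0 \<omega>)\<^sup>2)"
  shows "\<exists>E\<in>events. prob E \<le> 4 * exp (4 * v) / real n + v / ln (real n) \<and>
      (\<forall>\<omega>\<in>space M - E. \<forall>k<n. cmod (eig n k \<omega>) \<le> 5 * (sqrt (real n) * ln (real n)))"
proof -
  note [measurable] = rv
  have ln: "ln (real n) > 0" using n by simp
  have v0: "v \<ge> 0" unfolding v_def by (intro Bochner_Integration.integral_nonneg) simp
  define Q where "Q = sqrt (real n)"
  have Q: "Q > 0" "Q\<^sup>2 = real n" "Q * Q = real n" using n by (auto simp: Q_def)
  define tr :: "real \<Rightarrow> real" where "tr x = (if \<bar>x\<bar> \<le> Q then x else 0)" for x
  have [measurable]: "tr \<in> borel_measurable borel" unfolding tr_def by measurable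
  have tr_diff: "\<bar>x - tr x\<bar> \<le> x\<^sup>2 / Q" for x
  proof (cases "\<bar>x\<bar> \<le> Q")
    case False
    hence "\<bar>x\<bar> * Q \<le> \<bar>x\<bar> * \<bar>x\<bar>" by (intro mult_left_mono) auto
    hence "\<bar>x\<bar> \<le> x\<^sup>2 / Q" using Q by (simp add: pos_le_divide_eq power2_eq_square)
    thus ?thesis using False by (simp add: tr_def)
  qed (use Q in \<open>simp add: tr_def\<close>)
  have tr_bd: "\<bar>tr x\<bar> \<le> Q" "(tr x)\<^sup>2 \<le> x\<^sup>2" for x using Q by (auto simp: tr_def)
  have tr_int: "integrable M (\<lambda>\<omega>. tr (\<xi> 0 \<omega>))"
    by (intro integrable_const_bound[of _ Q]) (auto simp: tr_bd)
  \<comment> \<open>Truncation destroys mean zero, but a bias of v/Q costs only v/n in the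
    exponential moment when |t| <= 1/Q.\<close>
  have mean: "\<bar>expectation (\<lambda>\<omega>. tr (\<xi> 0 \<omega>))\<bar> \<le> v / Q"
  proof -
    have "expectation (\<lambda>\<omega>. tr (\<xi> 0 \<omega>)) = - expectation (\<lambda>\<omega>. \<xi> 0 \<omega> - tr (\<xi> 0 \<omega>))"
      using int tr_int by simp
    hence "\<bar>expectation (\<lambda>\<omega>. tr (\<xi> 0 \<omega>))\<bar> \<le> expectation (\<lambda>\<omega>. \<bar>\<xi> 0 \<omega> - tr (\<xi> 0 \<omega>)\<bar>)"
      using integral_abs_bound[of M "\<lambda>\<omega>. \<xi> 0 \<omega> - tr (\<xi> 0 \<omega>)"] by simp
    also have "\<dots> \<le> expectation (\<lambda>\<omega>. (\<xi> 0 \<omega>)\<^sup>2 / Q)"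
      using int tr_int sq by (intro integral_mono tr_diff) auto
    finally show ?thesis by (simp add: v_def)
  qed
  define Y where "Y j \<omega> = tr (\<xi> j \<omega>)" for j \<omega>
  define u where "u = 1 / Q"
  have u: "u > 0" using Q by (simp add: u_def)
  have mgf: "integrable M (\<lambda>\<omega>. exp (t * tr (\<xi> 0 \<omega>)))" "expectation (\<lambda>\<omega>. exp (t * tr (\<xi> 0 \<omega>))) \<le> exp (4 * v / real n)"
    if t: "\<bar>t\<bar> \<le> u" for t
  proof -
    have small: "\<bar>t * tr x\<bar> \<le> 1" for x
    proof -
      have "\<bar>t\<bar> * \<bar>tr x\<bar> \<le> u * Q" using t u tr_bd by (intro mult_mono) auto
      thus ?thesis using Q by (simp add: abs_mult u_def)
    qed
    have t2: "t\<^sup>2 \<le> 1 / real n"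
    proof -
      have "t\<^sup>2 \<le> u\<^sup>2" using t u by (metis abs_le_square_iff abs_of_pos)
      thus ?thesis by (simp add: u_def power_divide Q)
    qed
    show i: "integrable M (\<lambda>\<omega>. exp (t * tr (\<xi> 0 \<omega>)))"
    proof (intro integrable_const_bound[of _ "exp 1"] AE_I2)
      fix \<omega> show "norm (exp (t * tr (\<xi> 0 \<omega>))) \<le> exp 1" using small[of "\<xi> 0 \<omega>"] by simp
    qed measurable
    \<comment> \<open>The 3 bounds exp 1; the resulting 3v/n and the v/n from the bias add up to
      4v/n.\<close>
    have "exp (t * tr x) \<le> 1 + t * tr x + 3 / real n * x\<^sup>2" for x
    proof -
      have "exp \<bar>t * tr x\<bar> \<le> 3" using small[of x] exp_le by (meson exp_le_cancel_iff order_trans)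
      hence "(t * tr x)\<^sup>2 * exp \<bar>t * tr x\<bar> \<le> (1 / real n * x\<^sup>2) * 3"
        unfolding power_mult_distrib using t2 tr_bd[of x] by (intro mult_mono) auto
      thus ?thesis using exp_le_quadratic[of "t * tr x"] by (simp add: mult_ac)
    qed
    hence "expectation (\<lambda>\<omega>. exp (t * tr (\<xi> 0 \<omega>))) \<le> expectation (\<lambda>\<omega>. 1 + t * tr (\<xi> 0 \<omega>) + 3 / real n * (\<xi> 0 \<omega>)\<^sup>2)"
      using i tr_int sq by (intro integral_mono) auto
    also have "\<dots> = 1 + t * expectation (\<lambda>\<omega>. tr (\<xi> 0 \<omega>)) + 3 / real n * v"
      using tr_int sq prob_space by (simp add: v_def)
    also have "t * expectation (\<lambda>\<omega>. tr (\<xi> 0 \<omega>)) \<le> u * (v / Q)"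
    proof -
      have "\<bar>t\<bar> * \<bar>expectation (\<lambda>\<omega>. tr (\<xi> 0 \<omega>))\<bar> \<le> u * (v / Q)"
        using t mean u by (intro mult_mono) auto
      thus ?thesis by (simp only: abs_mult[symmetric])
    qed
    also have "u * (v / Q) = v / real n" using Q by (simp add: u_def)
    also have "1 + v / real n + 3 / real n * v = 1 + 4 * v / real n" by (simp add: field_simps)
    also have "\<dots> \<le> exp (4 * v / real n)" by (rule exp_ge_add_one_self)
    finally show "expectation (\<lambda>\<omega>. exp (t * tr (\<xi> 0 \<omega>))) \<le> exp (4 * v / real n)" by simp
  qed
  \<comment> \<open>Then u s = 2 ln n, again turning 4n into 4/n. The bound 2s = 4 Q ln n plus Q ln
    n from the discarded part gives the factor 5.\<close>
  define s where "s = 2 * Q * ln (real n)"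
  have "\<exists>E\<in>events. prob E \<le> 4 * real n * exp (real n * (4 * v / real n) - u * s) \<and>
      (\<forall>\<omega>\<in>space M - E. \<forall>k<n. cmod (circ_eig n (\<lambda>l. Y l \<omega>) k) \<le> 2 * s)"
  proof (rule circ_eig_max_tail[OF _ u])
    show "indep_vars (\<lambda>_. borel) Y {..<n}"
      unfolding Y_def by (rule indep_vars_compose2[OF indep_vars_subset[OF indep]]) auto
    show "integrable M (\<lambda>\<omega>. exp (t * Y j \<omega>)) \<and> expectation (\<lambda>\<omega>. exp (t * Y j \<omega>)) \<le> exp (4 * v / real n)"
      if "\<bar>t\<bar> \<le> u" for j t
      using ident_integral[of "\<lambda>x. exp (t * tr x)" j] mgf[OF that] unfolding Y_def by simp
  qed
  moreover have "4 * real n * exp (real n * (4 * v / real n) - u * s) = 4 * exp (4 * v) / real n"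
  proof -
    have "real n * (4 * v / real n) - u * s = 4 * v - 2 * ln (real n)"
      using n Q by (simp add: u_def s_def)
    moreover have "exp (4 * v - 2 * ln (real n)) = exp (4 * v) / (real n)\<^sup>2"
      using n by (simp add: exp_diff exp_double)
    ultimately show ?thesis using n by (simp add: power2_eq_square)
  qed
  ultimately obtain E1 where E1: "E1 \<in> events" "prob E1 \<le> 4 * exp (4 * v) / real n"
      "\<And>\<omega> k. \<omega> \<in> space M - E1 \<Longrightarrow> k < n \<Longrightarrow> cmod (circ_eig n (\<lambda>l. Y l \<omega>) k) \<le> 2 * s"
    by auto
  define E2 where "E2 = {\<omega> \<in> space M. (\<Sum>j<n. (\<xi> j \<omega>)\<^sup>2) \<ge> real n * ln (real n)}"
  have E2: "E2 \<in> events" unfolding E2_def by measurable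
  have sq_int: "integrable M (\<lambda>\<omega>. (\<xi> j \<omega>)\<^sup>2)" "expectation (\<lambda>\<omega>. (\<xi> j \<omega>)\<^sup>2) = v" for j
    using ident_integral[of "\<lambda>x. x\<^sup>2" j] sq unfolding v_def by simp_all
  have "prob E2 \<le> expectation (\<lambda>\<omega>. \<Sum>j<n. (\<xi> j \<omega>)\<^sup>2) / (real n * ln (real n))"
    unfolding E2_def using ln n sq_int
    by (intro integral_Markov_inequality_measure[where A = "space M"]) (auto intro!: AE_I2 sum_nonneg)
  also have "\<dots> = v / ln (real n)" using sq_int n by simp
  finally have E2p: "prob E2 \<le> v / ln (real n)" .
  have "prob (E1 \<union> E2) \<le> prob E1 + prob E2" using E1(1) E2 by (rule measure_Un_le)
  hence "prob (E1 \<union> E2) \<le> 4 * exp (4 * v) / real n + v / ln (real n)" using E1(2) E2p by linarith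
  moreover have "cmod (eig n k \<omega>) \<le> 5 * (sqrt (real n) * ln (real n))"
    if \<omega>: "\<omega> \<in> space M - (E1 \<union> E2)" and k: "k < n" for \<omega> k
  proof -
    have "eig n k \<omega> = circ_eig n (\<lambda>l. Y l \<omega>) k
        + (\<Sum>l<n. of_real (\<xi> l \<omega> - Y l \<omega>) * cis (2 * pi * real k / real n * real l))"
      unfolding circ_eig_def by (simp add: sum.distrib[symmetric] algebra_simps)
    hence "cmod (eig n k \<omega>) \<le> cmod (circ_eig n (\<lambda>l. Y l \<omega>) k)
        + cmod (\<Sum>l<n. of_real (\<xi> l \<omega> - Y l \<omega>) * cis (2 * pi * real k / real n * real l))"
      by (simp only: norm_triangle_ineq)
    also have "cmod (\<Sum>l<n. of_real (\<xi> l \<omega> - Y l \<omega>) * cis (2 * pi * real k / real n * real l))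
        \<le> (\<Sum>l<n. (\<xi> l \<omega>)\<^sup>2 / Q)"
      by (intro sum_norm_le) (simp add: norm_mult Y_def tr_diff flip: of_real_diff)
    also have "\<dots> = (\<Sum>l<n. (\<xi> l \<omega>)\<^sup>2) / Q" by (simp add: sum_divide_distrib)
    also have "\<dots> \<le> (Q * Q * ln (real n)) / Q"
      using \<omega> Q unfolding E2_def by (intro divide_right_mono) auto
    also have "\<dots> = Q * ln (real n)" using Q(1) by simp
    also have "cmod (circ_eig n (\<lambda>l. Y l \<omega>) k) \<le> 2 * s" using E1(3)[of \<omega> k] \<omega> k by auto
    finally show ?thesis by (simp add: s_def Q_def)
  qed
  ultimately show ?thesis using E1(1) E2 by (intro bexI[of _ "E1 \<union> E2"]) auto
qed

text \<open>Union bound over three kinds of index: at most two with a real eigenvalue, at most sqrt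
  n of order at most D, about n^(1/4), and the rest. For the rest the radius t = \<epsilon>
  n^(-\<rho>) gives probability O(t^2/n) up to tiny terms, because t D grows like a power of n when
  \<rho> < 1/4. The first two kinds are few enough to afford a larger radius.\<close>

lemma min_eig_tail:
  "\<exists>C>0. \<forall>\<epsilon>>0. \<forall>\<rho>. 0 < \<rho> \<and> \<rho> < 1/4 \<longrightarrow> (\<forall>\<^sub>F n in sequentially.
     \<exists>E\<in>events. prob E \<le> C * (\<epsilon>\<^sup>2 * real n powr (-2 * \<rho>) + ln (real n) * real n powr (-1/2)) \<and>
       (\<forall>\<omega>\<in>space M - E. \<forall>k<n. \<epsilon> * real n powr (-\<rho>) \<le> cmod (eig n k \<omega>)))"
proof -
  \<comment> \<open>In order: the generic, the real and the small-order contribution; 8 = 4 + 2 + 1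
    + 1 collects the remaining error terms.\<close>
  define C where "C = exp (1/2) * (2 / \<gamma> + 2 * sqrt 8 / (c * sqrt \<gamma>) + 16 / (c\<^sup>2 * \<gamma>) + 8)"
  have C: "C > 0" unfolding C_def using \<gamma> c by (intro mult_pos_pos add_pos_pos) auto
  show ?thesis
  proof (intro exI[of _ C] conjI C allI impI)
    fix \<epsilon> \<rho> :: real assume \<epsilon>: "\<epsilon> > 0" and \<rho>: "0 < \<rho> \<and> \<rho> < 1/4"
    \<comment> \<open>n^\<theta> is the square of n^(-\<rho>) n^(1/4). The constant \<beta> below
      has 16 pi instead of 8 pi because D is only known to be at least n^(1/4)/2.\<close>
    define \<theta> where "\<theta> = 1 / 2 - 2 * \<rho>"
    have \<theta>: "\<theta> > 0" using \<rho> by (simp add: \<theta>_def)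
    define \<beta> where "\<beta> = (\<epsilon> * (c / (16 * pi)))\<^sup>2 / 4"
    have \<beta>: "\<beta> > 0" using \<epsilon> c by (simp add: \<beta>_def)
    define \<gamma>' where "\<gamma>' = \<gamma> * c\<^sup>2 / 64"
    have \<gamma>': "\<gamma>' > 0" using \<gamma> c by (simp add: \<gamma>'_def)
    have "\<forall>\<^sub>F n in sequentially. \<epsilon> * real n powr (-\<rho>) \<le> sqrt (8 * ln (real n)) / c"
      using \<epsilon> \<rho> c by real_asymp
    moreover have "\<forall>\<^sub>F n in sequentially. real n * exp (- (\<gamma>' * real n)) \<le> ln (real n) * real n powr (-1/2)"
      using \<gamma>' by real_asymp
    moreover have "\<forall>\<^sub>F n in sequentially. 2 * real n * exp (- (\<beta> * real n powr \<theta>)) \<le> ln (real n) * real n powr (-1/2)"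
      using \<beta> \<theta> by real_asymp
    moreover have "\<forall>\<^sub>F n in sequentially. 1 \<le> ln (real n)" by real_asymp
    ultimately show "\<forall>\<^sub>F n in sequentially.
     \<exists>E\<in>events. prob E \<le> C * (\<epsilon>\<^sup>2 * real n powr (-2 * \<rho>) + ln (real n) * real n powr (-1/2)) \<and>
       (\<forall>\<omega>\<in>space M - E. \<forall>k<n. \<epsilon> * real n powr (-\<rho>) \<le> cmod (eig n k \<omega>))"
      using eventually_ge_at_top[of 1]
    proof eventually_elim
      fix n :: nat
      assume e1: "\<epsilon> * real n powr (-\<rho>) \<le> sqrt (8 * ln (real n)) / c"
        and e2: "real n * exp (- (\<gamma>' * real n)) \<le> ln (real n) * real n powr (-1/2)"
        and e3: "2 * real n * exp (- (\<beta> * real n powr \<theta>)) \<le> ln (real n) * real n powr (-1/2)"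
        and ln: "1 \<le> ln (real n)" and n: "1 \<le> n"
      define t where "t = \<epsilon> * real n powr (-\<rho>)"
      \<comment> \<open>Enlarging the radius from t to T only enlarges the event and makes the
        high-frequency error exp(-(T c)^2/4) equal to n^(-2). Summed over at most sqrt n indices,
        T^2/n still contributes only O(ln n / sqrt n).\<close>
      define T where "T = sqrt (8 * ln (real n)) / c"
      define w where "w = ln (real n) * real n powr (-1/2)"
      define D where "D = nat \<lfloor>real n powr (1/4)\<rfloor>"
      have n0: "n > 0" using n by simp
      have t: "t > 0" using \<epsilon> n by (simp add: t_def)
      have T: "T > 0" "t \<le> T" using ln c e1 by (simp_all add: T_def t_def)
      have q1: "1 \<le> real n powr (1/4)" using n by (intro ge_one_powr_ge_zero) auto
      have D: "1 \<le> D" "real D \<le> real n powr (1/4)" "real n powr (1/4) / 2 \<le> real D"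
        using nat_floor_bounds[OF q1] unfolding D_def by simp_all
      have w: "w = ln (real n) / sqrt (real n)"
        using n by (simp add: w_def powr_minus_divide powr_half_sqrt)
      have D2: "(real D)\<^sup>2 \<le> sqrt (real n)"
      proof -
        have "(real D)\<^sup>2 \<le> (real n powr (1/4))\<^sup>2" using D by (intro power_mono) auto
        also have "\<dots> = real n powr (1/2)" using n by (simp add: powr_power)
        finally show ?thesis using n by (simp add: powr_half_sqrt)
      qed
      have tail: "exp (- (T * c)\<^sup>2 / 4) = 1 / (real n)\<^sup>2"
      proof -
        have "(T * c)\<^sup>2 = 8 * ln (real n)" using c ln by (simp add: T_def)
        hence "- (T * c)\<^sup>2 / 4 = - (2 * ln (real n))" by simp
        thus ?thesis using n by (simp add: exp_minus exp_double inverse_eq_divide)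
      qed
      define L1 where "L1 = exp (1 / 2) * (2 * T\<^sup>2 / (\<gamma> * real n) + 2 * (1 / (real n)\<^sup>2))"
      define L2 where "L2 = exp (1 / 2) * (2 * t\<^sup>2 / (\<gamma> * real n) + exp (- (\<gamma> * c\<^sup>2 * real n / 64))
           + 2 * exp (- (t * (c * real D / (8 * pi)))\<^sup>2 / 4))"
      define L3 where "L3 = exp (1 / 2) * (T / sqrt (\<gamma> * real n) + 2 * (1 / (real n)\<^sup>2))"
      have L0: "L1 \<ge> 0" "L2 \<ge> 0" "L3 \<ge> 0" using \<gamma> T(1) by (simp_all add: L1_def L2_def L3_def)
      define A where "A k = {\<omega> \<in> space M. cmod (eig n k \<omega>) \<le> t}" for k
      have Am: "A k \<in> events" for k unfolding A_def by measurable
      have AT: "prob (A k) \<le> prob {\<omega> \<in> space M. cmod (eig n k \<omega>) \<le> T}" for k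
        unfolding A_def using T(2) by (intro finite_measure_mono) auto
      let ?bad = "\<lambda>k. \<exists>m. 1 \<le> m \<and> m \<le> D \<and> n dvd k * m"
      have pk: "prob (A k) \<le> (if n dvd k * 2 then L3 else 0) + (if ?bad k then L1 else 0) + L2" for k
      proof -
        consider "n dvd 2 * k" | "\<not> n dvd 2 * k" "?bad k" | "\<not> n dvd 2 * k" "\<not> ?bad k" by blast
        thus ?thesis
        proof cases
          case 1
          have "prob (A k) \<le> L3"
            using AT[of k] prob_eig_real_le[OF n0 1 T(1)] unfolding tail L3_def by linarith
          thus ?thesis using 1 L0 by (simp add: mult.commute)
        next
          case 2
          have "prob (A k) \<le> L1"
            using AT[of k] prob_eig_complex_le(1)[OF n0 2(1) T(1)] unfolding tail L1_def by linarith
          thus ?thesis using 2 L0 by (simp add: mult.commute)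
        next
          case 3
          have "prob (A k) \<le> L2" unfolding A_def L2_def
            by (rule prob_eig_complex_le(2)[OF n0 3(1) t]) (use D 3(2) in auto)
          thus ?thesis using L0 by simp
        qed
      qed
      let ?E = "\<Union>k<n. A k"
      have "prob ?E \<le> (\<Sum>k<n. prob (A k))" using Am by (intro finite_measure_subadditive_finite) auto
      also have "\<dots> \<le> (\<Sum>k<n. (if n dvd k * 2 then L3 else 0) + (if ?bad k then L1 else 0) + L2)"
        by (intro sum_mono pk)
      also have "\<dots> = real (card {k. k < n \<and> n dvd k * 2}) * L3 + real (card {k. k < n \<and> ?bad k}) * L1 + real n * L2"
        by (simp add: sum.distrib sum.If_cases Int_def lessThan_def conj_commute)
      also have "\<dots> \<le> 2 * L3 + sqrt (real n) * L1 + real n * L2"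
      proof (intro add_mono mult_right_mono L0 order_refl)
        show "real (card {k. k < n \<and> n dvd k * 2}) \<le> 2" using card_dvd_mult_le[OF n0, of 2] by simp
        have "real (card {k. k < n \<and> ?bad k}) \<le> real (D\<^sup>2)"
          using card_small_order_le[OF n0, of D] by (simp only: of_nat_le_iff)
        thus "real (card {k. k < n \<and> ?bad k}) \<le> sqrt (real n)"
          using D2 unfolding of_nat_power by linarith
      qed
      also have "\<dots> \<le> C * (t\<^sup>2 + w)"
      proof -
        have sq: "sqrt (real n) \<ge> 1" "sqrt (real n) * sqrt (real n) = real n" using n by auto
        have w1: "1 / real n \<le> w"
        proof -
          have "1 / real n = 1 / sqrt (real n) * (1 / sqrt (real n))" using sq by simp
          also have "\<dots> \<le> ln (real n) * (1 / sqrt (real n))"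
          proof (rule mult_right_mono)
            have "1 / sqrt (real n) \<le> 1" using sq by simp
            thus "1 / sqrt (real n) \<le> ln (real n)" using ln by linarith
          qed simp
          finally show ?thesis by (simp add: w)
        qed
        have w0: "w \<ge> 0" using ln by (simp add: w)
        have i1: "T / sqrt (\<gamma> * real n) \<le> sqrt 8 / (c * sqrt \<gamma>) * w"
        proof -
          have "ln (real n) * 1 \<le> ln (real n) * ln (real n)" using ln by (intro mult_left_mono) auto
          hence "sqrt (ln (real n)) \<le> ln (real n)" using ln by (intro real_le_lsqrt) (auto simp: power2_eq_square)
          hence "sqrt 8 * sqrt (ln (real n)) / (c * (sqrt \<gamma> * sqrt (real n))) \<le> sqrt 8 * ln (real n) / (c * (sqrt \<gamma> * sqrt (real n)))"
            using c \<gamma> by (intro divide_right_mono mult_left_mono) auto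
          thus ?thesis by (simp add: T_def w real_sqrt_mult mult_ac)
        qed
        have i2: "sqrt (real n) * (2 * T\<^sup>2 / (\<gamma> * real n)) = 16 / (c\<^sup>2 * \<gamma>) * w"
        proof -
          have "sqrt (real n) / real n = 1 / sqrt (real n)" using sq n by (simp add: real_div_sqrt field_simps)
          moreover have "T\<^sup>2 = 8 * ln (real n) / c\<^sup>2" using ln by (simp add: T_def power_divide)
          moreover have "sqrt (real n) * (2 * T\<^sup>2 / (\<gamma> * real n)) = 2 * T\<^sup>2 / \<gamma> * (sqrt (real n) / real n)"
            by simp
          ultimately show ?thesis by (simp add: w mult_ac)
        qed
        have i3: "real n * (2 * t\<^sup>2 / (\<gamma> * real n)) = 2 / \<gamma> * t\<^sup>2" using n by simp
        have i4: "1 / (real n)\<^sup>2 \<le> w"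
        proof -
          have "1 / (real n)\<^sup>2 \<le> 1 / real n" using n by (intro divide_left_mono) (auto simp: power2_eq_square)
          thus ?thesis using w1 by linarith
        qed
        have i5: "sqrt (real n) * (2 * (1 / (real n)\<^sup>2)) \<le> 2 * w"
        proof -
          have "sqrt (real n) * 1 \<le> sqrt (real n) * sqrt (real n)" using sq by (intro mult_left_mono) auto
          hence "sqrt (real n) \<le> real n" using sq(2) by simp
          hence "sqrt (real n) / (real n)\<^sup>2 \<le> real n / (real n)\<^sup>2" by (intro divide_right_mono) auto
          also have "\<dots> = 1 / real n" using n by (simp add: power2_eq_square)
          finally have "2 * (sqrt (real n) / (real n)\<^sup>2) \<le> 2 * w" using w1 by linarith
          thus ?thesis by (simp add: mult.commute)
        qed
        have i6: "real n * exp (- (\<gamma> * c\<^sup>2 * real n / 64)) \<le> w"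
          using e2 unfolding \<gamma>'_def w_def by simp
        have i7: "real n * (2 * exp (- (t * (c * real D / (8 * pi)))\<^sup>2 / 4)) \<le> w"
        proof -
          have "\<beta> * real n powr \<theta> \<le> (t * (c * real D / (8 * pi)))\<^sup>2 / 4"
          proof -
            have "\<epsilon> * (c / (16 * pi)) * (real n powr (-\<rho>) * real n powr (1/4))
                = t * (c * (real n powr (1/4) / 2) / (8 * pi))" by (simp add: t_def)
            also have "\<dots> \<le> t * (c * real D / (8 * pi))"
              using t c D(3) by (intro mult_left_mono divide_right_mono) auto
            finally have "(\<epsilon> * (c / (16 * pi)))\<^sup>2 * (real n powr (-\<rho>) * real n powr (1/4))\<^sup>2 \<le> (t * (c * real D / (8 * pi)))\<^sup>2"
              unfolding power_mult_distrib[symmetric] using \<epsilon> c by (intro power_mono) auto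
            moreover have "(real n powr (-\<rho>) * real n powr (1/4))\<^sup>2 = real n powr \<theta>"
              using n by (simp add: powr_add[symmetric] powr_power \<theta>_def algebra_simps)
            ultimately show ?thesis unfolding \<beta>_def by simp
          qed
          hence "exp (- (t * (c * real D / (8 * pi)))\<^sup>2 / 4) \<le> exp (- (\<beta> * real n powr \<theta>))" by simp
          hence "2 * real n * exp (- (t * (c * real D / (8 * pi)))\<^sup>2 / 4) \<le> 2 * real n * exp (- (\<beta> * real n powr \<theta>))"
            by (intro mult_left_mono) auto
          thus ?thesis using e3 unfolding w_def by simp
        qed
        define P1 P2 P3 where "P1 = sqrt 8 / (c * sqrt \<gamma>)" and "P2 = 16 / (c\<^sup>2 * \<gamma>)" and "P3 = 2 / \<gamma>"
        have P: "P1 \<ge> 0" "P2 \<ge> 0" "P3 \<ge> 0" using c \<gamma> by (simp_all add: P1_def P2_def P3_def)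
        have alg: "2 * (e * (A + 2 * B)) + q * (e * (F + 2 * B)) + m * (e * (G + H + 2 * J))
          = e * (2 * A + 4 * B + (q * F + q * (2 * B)) + (m * G + m * H + m * (2 * J)))" for e A B q F m G H J :: real
          by (simp add: algebra_simps)
        have "2 * L3 + sqrt (real n) * L1 + real n * L2 = exp (1/2) *
          (2 * (T / sqrt (\<gamma> * real n)) + 4 * (1 / (real n)\<^sup>2)
           + (sqrt (real n) * (2 * T\<^sup>2 / (\<gamma> * real n)) + sqrt (real n) * (2 * (1 / (real n)\<^sup>2)))
           + (real n * (2 * t\<^sup>2 / (\<gamma> * real n)) + real n * exp (- (\<gamma> * c\<^sup>2 * real n / 64))
              + real n * (2 * exp (- (t * (c * real D / (8 * pi)))\<^sup>2 / 4))))"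
          unfolding L1_def L2_def L3_def by (rule alg)
        also have "\<dots> \<le> exp (1/2) * (2 * (P1 * w) + 4 * w + (P2 * w + 2 * w) + (P3 * t\<^sup>2 + w + w))"
          unfolding P1_def P2_def P3_def
          using i1 i2 i3 i4 i5 i6 i7 by (intro mult_left_mono add_mono) auto
        also have "\<dots> \<le> exp (1/2) * ((P3 + 2 * P1 + P2 + 8) * (t\<^sup>2 + w))"
        proof (rule mult_left_mono)
          have "0 \<le> (2 * P1 + P2 + 8) * t\<^sup>2" "0 \<le> P3 * w" using P w0 by simp_all
          thus "2 * (P1 * w) + 4 * w + (P2 * w + 2 * w) + (P3 * t\<^sup>2 + w + w) \<le> (P3 + 2 * P1 + P2 + 8) * (t\<^sup>2 + w)"
            by (simp add: algebra_simps)
        qed simp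
        also have "\<dots> = C * (t\<^sup>2 + w)" by (simp add: C_def P1_def P2_def P3_def mult.assoc)
        finally show ?thesis .
      qed
      also have "t\<^sup>2 = \<epsilon>\<^sup>2 * real n powr (-2 * \<rho>)" using n by (simp add: t_def power_mult_distrib powr_power mult.commute)
      finally have "prob ?E \<le> C * (\<epsilon>\<^sup>2 * real n powr (-2 * \<rho>) + ln (real n) * real n powr (-1/2))"
        unfolding w_def .
      moreover have "?E \<in> events" using Am by auto
      moreover have "\<forall>\<omega>\<in>space M - ?E. \<forall>k<n. \<epsilon> * real n powr (-\<rho>) \<le> cmod (eig n k \<omega>)"
        by (auto simp: A_def t_def)
      ultimately show "\<exists>E\<in>events. prob E \<le> C * (\<epsilon>\<^sup>2 * real n powr (-2 * \<rho>) + ln (real n) * real n powr (-1/2)) \<and>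
       (\<forall>\<omega>\<in>space M - E. \<forall>k<n. \<epsilon> * real n powr (-\<rho>) \<le> cmod (eig n k \<omega>))" by blast
    qed
  qed
qed

section \<open>Combining both eigenvalue bounds into the condition number estimate\<close>

lemma prob_cond_number_ge:
  assumes n: "n > 0" and a: "a > 0" and E: "E1 \<in> events" "E2 \<in> events"
    and lo: "\<forall>\<omega>\<in>space M - E1. \<forall>k<n. a \<le> cmod (eig n k \<omega>)"
    and hi: "\<forall>\<omega>\<in>space M - E2. \<forall>k<n. cmod (eig n k \<omega>) \<le> b"
  shows "1 - (prob E1 + prob E2)
      \<le> prob {\<omega> \<in> space M. cond_number n (circulant n (\<lambda>k. \<xi> k \<omega>)) \<le> ereal (b / a)}"
proof -
  note [measurable] = borel_measurable_cond_number_circulant[OF n rv]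
  have "prob (E1 \<union> E2) \<le> prob E1 + prob E2" using E by (rule measure_Un_le)
  hence "1 - (prob E1 + prob E2) \<le> prob (space M - (E1 \<union> E2))"
    using E by (subst prob_compl) auto
  also have "\<dots> \<le> prob {\<omega> \<in> space M. cond_number n (circulant n (\<lambda>k. \<xi> k \<omega>)) \<le> ereal (b / a)}"
  proof (rule finite_measure_mono)
    show "space M - (E1 \<union> E2) \<subseteq> {\<omega> \<in> space M. cond_number n (circulant n (\<lambda>k. \<xi> k \<omega>)) \<le> ereal (b / a)}"
      using lo hi by (auto intro!: cond_number_circulant_le[OF n a])
  qed measurable
  finally show ?thesis .
qed

end

theorem mainTheorem6:
  fixes M :: "'w measure" and \<xi> :: "nat \<Rightarrow> 'w \<Rightarrow> real"
  assumes "prob_space M"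
    and rv: "\<And>i. \<xi> i \<in> borel_measurable M"
    and indep: "prob_space.indep_vars M (\<lambda>_. borel) \<xi> UNIV"
    and ident: "\<And>i. distr M borel (\<xi> i) = distr M borel (\<xi> 0)"
    and H: "\<exists>K>0. \<exists>q. 0 < q \<and> q < 1
              \<and> (\<forall>u. measure M {\<omega>\<in>space M. \<bar>\<xi> 0 \<omega> - u\<bar> \<le> 1} \<le> 1 - q)
              \<and> measure M {\<omega>\<in>space M. \<bar>\<xi> 0 \<omega>\<bar> > K} \<le> q / 2"
  shows
   "((integrable M (\<xi> 0) \<and> (\<integral>\<omega>. \<xi> 0 \<omega> \<partial>M) = 0
      \<and> integrable M (\<lambda>\<omega>. (\<xi> 0 \<omega>)\<^sup>2)
      \<and> (\<integral>\<omega>. (\<xi> 0 \<omega> - (\<integral>\<omega>'. \<xi> 0 \<omega>' \<partial>M))\<^sup>2 \<partial>M) > 0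
      \<and> (\<exists>a>0. \<forall>t\<in>{-a<..<a}. integrable M (\<lambda>\<omega>. exp (t * \<xi> 0 \<omega>))))
     \<longrightarrow>
     (\<exists>C0>0. \<exists>C1>0. \<forall>\<epsilon>>0. \<forall>\<rho>. 0 < \<rho> \<and> \<rho> < 1/4 \<longrightarrow>
        (\<exists>\<delta>::nat \<Rightarrow> real. \<delta> \<longlonglongrightarrow> 0 \<and>
          (\<forall>\<^sub>F n in sequentially.
             measure M {\<omega>\<in>space M.
               cond_number n (circulant n (\<lambda>k. \<xi> k \<omega>))
                 \<le> ereal (C0 / \<epsilon> * real n powr (\<rho> + 1/2) * sqrt (ln (real n)))}
             \<ge> 1 - C1 * ((\<epsilon>\<^sup>2 + \<epsilon>) * real n powr (-2 * \<rho>)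
                          + real n powr (-1/2 + \<delta> n))))))
    \<and>
    ((integrable M (\<xi> 0) \<and> (\<integral>\<omega>. \<xi> 0 \<omega> \<partial>M) = 0
      \<and> integrable M (\<lambda>\<omega>. (\<xi> 0 \<omega>)\<^sup>2))
     \<longrightarrow>
     (\<exists>C0>0. \<exists>C2>0. \<forall>\<epsilon>>0. \<forall>\<rho>. 0 < \<rho> \<and> \<rho> < 1/4 \<longrightarrow>
        (\<forall>\<^sub>F n in sequentially.
             measure M {\<omega>\<in>space M.
               cond_number n (circulant n (\<lambda>k. \<xi> k \<omega>))
                 \<le> ereal (C0 / \<epsilon> * real n powr (\<rho> + 1/2) * ln (real n))}
             \<ge> 1 - C2 * ((\<epsilon>\<^sup>2 + \<epsilon>) * real n powr (-2 * \<rho>)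
                          + (ln (real n)) powr (-1/2)))))"
proof -
  obtain K q where K: "K > 0" and q: "0 < q" "q < 1"
    and conc: "\<And>u. measure M {\<omega>\<in>space M. \<bar>\<xi> 0 \<omega> - u\<bar> \<le> 1} \<le> 1 - q"
    and tail: "measure M {\<omega>\<in>space M. \<bar>\<xi> 0 \<omega>\<bar> > K} \<le> q / 2"
    using H by blast
  interpret prob_space M by fact
  note [measurable] = rv
  interpret \<mu>: real_distribution "distr M borel (\<xi> 0)" by (rule real_distribution_distr[OF rv])
  have preimage: "measure (distr M borel (\<xi> 0)) {x. P x} = measure M {\<omega>\<in>space M. P (\<xi> 0 \<omega>)}"
    if "{x. P x} \<in> sets borel" for P
    using that by (subst measure_distr) (auto intro!: arg_cong[where f = "measure M"])
  interpret circulant_iid M \<xi> "q\<^sup>2 / 16" "1 / (2 * K)"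
  proof
    show "indep_vars (\<lambda>_. borel) \<xi> UNIV" by (rule indep)
    show "q\<^sup>2 / 16 * s\<^sup>2 \<le> char_gap (distr M borel (\<xi> 0)) s" if "\<bar>s\<bar> \<le> 1 / (2 * K)" for s
      using that conc tail by (intro \<mu>.char_gap_ge[OF K q]) (subst preimage; simp)+
  qed (use rv ident q K in auto)
  obtain C where C: "C > 0" and min: "\<And>\<epsilon> \<rho>. \<epsilon> > 0 \<Longrightarrow> 0 < \<rho> \<and> \<rho> < 1/4 \<Longrightarrow> \<forall>\<^sub>F n in sequentially.
     \<exists>E\<in>events. prob E \<le> C * (\<epsilon>\<^sup>2 * real n powr (-2 * \<rho>) + ln (real n) * real n powr (-1/2)) \<and>
       (\<forall>\<omega>\<in>space M - E. \<forall>k<n. \<epsilon> * real n powr (-\<rho>) \<le> cmod (eig n k \<omega>))"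
    using min_eig_tail by blast
  \<comment> \<open>Ratio of the upper to the lower eigenvalue bound; L will be sqrt (ln n) in the
    first part and ln n in the second.\<close>
  have quotient: "B * (sqrt (real n) * L) / (\<epsilon> * real n powr (-\<rho>)) = B / \<epsilon> * real n powr (\<rho> + 1/2) * L"
    if "n > 0" for B L \<epsilon> \<rho> and n :: nat
    using that unfolding powr_add powr_minus by (simp add: powr_half_sqrt field_simps)
  show ?thesis
  proof (intro conjI impI, goal_cases)
    case 1
    then obtain a where a: "a > 0" "\<And>t. \<bar>t\<bar> < a \<Longrightarrow> integrable M (\<lambda>\<omega>. exp (t * \<xi> 0 \<omega>))"
      by (auto simp: abs_less_iff)
    obtain B where B: "B > 0" and max: "\<forall>\<^sub>F n in sequentially. \<exists>E\<in>events. prob E \<le> 4 / real n \<and>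
      (\<forall>\<omega>\<in>space M - E. \<forall>k<n. cmod (eig n k \<omega>) \<le> B * sqrt (real n * ln (real n)))"
      using max_eig_subexponential[OF _ _ a] 1 by blast
    show ?case
    proof (rule exI[of _ B], intro conjI B, rule exI[of _ "C + 4"], intro conjI allI impI)
      show "0 < C + 4" using C by simp
      fix \<epsilon> \<rho> :: real assume \<epsilon>: "\<epsilon> > 0" and \<rho>: "0 < \<rho> \<and> \<rho> < 1/4"
      \<comment> \<open>Chosen so that n^(\<delta> n) = ln n eventually, which writes the error ln n
        / sqrt n in the required form.\<close>
      define \<delta> where "\<delta> n = ln (ln (real n)) / ln (real n)" for n :: nat
      have "\<delta> \<longlonglongrightarrow> 0" unfolding \<delta>_def by real_asymp
      moreover have "\<forall>\<^sub>F n in sequentially. 1 \<le> ln (real n)" by real_asymp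
      hence "\<forall>\<^sub>F n in sequentially.
             measure M {\<omega>\<in>space M.
               cond_number n (circulant n (\<lambda>k. \<xi> k \<omega>))
                 \<le> ereal (B / \<epsilon> * real n powr (\<rho> + 1/2) * sqrt (ln (real n)))}
             \<ge> 1 - (C + 4) * ((\<epsilon>\<^sup>2 + \<epsilon>) * real n powr (-2 * \<rho>)
                          + real n powr (-1/2 + \<delta> n))"
        using min[OF \<epsilon> \<rho>] max eventually_ge_at_top[of 1]
      proof eventually_elim
        case (elim n)
        from elim(2) obtain E1 where E1: "E1 \<in> events"
          "prob E1 \<le> C * (\<epsilon>\<^sup>2 * real n powr (-2 * \<rho>) + ln (real n) * real n powr (-1/2))"
          "\<forall>\<omega>\<in>space M - E1. \<forall>k<n. \<epsilon> * real n powr (-\<rho>) \<le> cmod (eig n k \<omega>)" by blast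
        from elim(3) obtain E2 where E2: "E2 \<in> events" "prob E2 \<le> 4 / real n"
          "\<forall>\<omega>\<in>space M - E2. \<forall>k<n. cmod (eig n k \<omega>) \<le> B * sqrt (real n * ln (real n))" by blast
        have n: "n > 0" using elim by simp
        have "real n powr \<delta> n = ln (real n)"
        proof -
          have "ln (real n) \<noteq> 0" "ln (real n) > 0" using elim(1) by auto
          hence "\<delta> n * ln (real n) = ln (ln (real n))"
            unfolding \<delta>_def by (simp only: times_divide_eq_left nonzero_mult_div_cancel_right not_False_eq_True)
          thus ?thesis using n \<open>ln (real n) > 0\<close> by (simp only: powr_def) (simp del: ln_gt_zero_iff)
        qed
        hence w: "real n powr (-1/2 + \<delta> n) = ln (real n) * real n powr (-1/2)"
          unfolding powr_add by (simp only: mult.commute)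
        have "prob E1 + prob E2 \<le> (C + 4) * ((\<epsilon>\<^sup>2 + \<epsilon>) * real n powr (-2 * \<rho>) + real n powr (-1/2 + \<delta> n))"
        proof -
          define x y where "x = real n powr (-2 * \<rho>)" and "y = ln (real n) * real n powr (-1/2)"
          have "1 / real n = real n powr (-1)" using n by (simp add: powr_minus_divide)
          also have "\<dots> \<le> real n powr (-1/2)" using n by (intro powr_mono) auto
          also have "\<dots> \<le> y" unfolding y_def using elim(1) mult_right_mono[of 1 "ln (real n)" "real n powr (-1/2)"] by simp
          finally have "4 / real n \<le> 4 * y" by simp
          hence "prob E1 + prob E2 \<le> C * (\<epsilon>\<^sup>2 * x + y) + 4 * y" using E1(2) E2(2) unfolding x_def y_def by linarith
          also have "\<dots> \<le> (C + 4) * ((\<epsilon>\<^sup>2 + \<epsilon>) * x + y)"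
          proof -
            have "0 \<le> C * (\<epsilon> * x)" "0 \<le> 4 * ((\<epsilon>\<^sup>2 + \<epsilon>) * x)" using C \<epsilon> by (simp_all add: x_def)
            thus ?thesis by (simp add: algebra_simps)
          qed
          finally show ?thesis by (simp only: w x_def y_def)
        qed
        moreover have "1 - (prob E1 + prob E2) \<le> prob {\<omega> \<in> space M. cond_number n (circulant n (\<lambda>k. \<xi> k \<omega>))
            \<le> ereal (B * sqrt (real n * ln (real n)) / (\<epsilon> * real n powr (-\<rho>)))}"
          using n \<epsilon> by (intro prob_cond_number_ge E1 E2) auto
        ultimately show ?case
          unfolding real_sqrt_mult quotient[OF n] by linarith
      qed
      ultimately show "\<exists>\<delta>::nat \<Rightarrow> real. \<delta> \<longlonglongrightarrow> 0 \<and>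
          (\<forall>\<^sub>F n in sequentially.
             measure M {\<omega>\<in>space M.
               cond_number n (circulant n (\<lambda>k. \<xi> k \<omega>))
                 \<le> ereal (B / \<epsilon> * real n powr (\<rho> + 1/2) * sqrt (ln (real n)))}
             \<ge> 1 - (C + 4) * ((\<epsilon>\<^sup>2 + \<epsilon>) * real n powr (-2 * \<rho>)
                          + real n powr (-1/2 + \<delta> n)))" by blast
    qed
  next
    case 2
    define v where "v = expectation (\<lambda>\<omega>. (\<xi> 0 \<omega>)\<^sup>2)"
    have v: "v \<ge> 0" unfolding v_def by (intro Bochner_Integration.integral_nonneg) simp
    define C2 where "C2 = C + 4 * exp (4 * v) + v"
    have C2: "C2 > 0" unfolding C2_def using C v by (intro add_pos_nonneg) auto
    show ?case
    proof (rule exI[of _ 5], intro conjI, simp, rule exI[of _ C2], intro conjI C2 allI impI)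
      fix \<epsilon> \<rho> :: real assume \<epsilon>: "\<epsilon> > 0" and \<rho>: "0 < \<rho> \<and> \<rho> < 1/4"
      \<comment> \<open>The error ln n / sqrt n of the minimum and the errors 1/n (Chernoff) and
        1/ln n (Markov) of the maximum are all eventually below (ln n)^(-1/2).\<close>
      have "\<forall>\<^sub>F n in sequentially. ln (real n) * real n powr (-1/2) \<le> ln (real n) powr (-1/2)"
        "\<forall>\<^sub>F n in sequentially. 1 / real n \<le> ln (real n) powr (-1/2)"
        "\<forall>\<^sub>F n in sequentially. 1 / ln (real n) \<le> ln (real n) powr (-1/2)"
        by real_asymp+
      thus "\<forall>\<^sub>F n in sequentially.
             measure M {\<omega>\<in>space M.
               cond_number n (circulant n (\<lambda>k. \<xi> k \<omega>))
                 \<le> ereal (5 / \<epsilon> * real n powr (\<rho> + 1/2) * ln (real n))}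
             \<ge> 1 - C2 * ((\<epsilon>\<^sup>2 + \<epsilon>) * real n powr (-2 * \<rho>)
                          + (ln (real n)) powr (-1/2))"
        using min[OF \<epsilon> \<rho>] eventually_ge_at_top[of 2]
      proof eventually_elim
        case (elim n)
        from elim(4) obtain E1 where E1: "E1 \<in> events"
          "prob E1 \<le> C * (\<epsilon>\<^sup>2 * real n powr (-2 * \<rho>) + ln (real n) * real n powr (-1/2))"
          "\<forall>\<omega>\<in>space M - E1. \<forall>k<n. \<epsilon> * real n powr (-\<rho>) \<le> cmod (eig n k \<omega>)" by blast
        obtain E2 where E2: "E2 \<in> events" "prob E2 \<le> 4 * exp (4 * v) / real n + v / ln (real n)"
          "\<forall>\<omega>\<in>space M - E2. \<forall>k<n. cmod (eig n k \<omega>) \<le> 5 * (sqrt (real n) * ln (real n))"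
          using max_eig_second_moment[of n] 2 elim(5) unfolding v_def by blast
        have n: "n > 0" using elim by simp
        have "prob E1 + prob E2 \<le> C2 * ((\<epsilon>\<^sup>2 + \<epsilon>) * real n powr (-2 * \<rho>) + ln (real n) powr (-1/2))"
        proof -
          define x y where "x = real n powr (-2 * \<rho>)" and "y = ln (real n) powr (-1/2)"
          have "4 * exp (4 * v) * (1 / real n) \<le> 4 * exp (4 * v) * y" "v * (1 / ln (real n)) \<le> v * y"
            "C * (\<epsilon>\<^sup>2 * x + ln (real n) * real n powr (-1/2)) \<le> C * (\<epsilon>\<^sup>2 * x + y)"
            using elim v C unfolding y_def by (intro mult_left_mono add_left_mono; simp)+
          hence "prob E1 + prob E2 \<le> C * (\<epsilon>\<^sup>2 * x + y) + 4 * exp (4 * v) * y + v * y"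
            using E1(2) E2(2) unfolding x_def by simp
          also have "\<dots> \<le> C2 * ((\<epsilon>\<^sup>2 + \<epsilon>) * x + y)"
          proof -
            have "0 \<le> C * (\<epsilon> * x)" "0 \<le> (4 * exp (4 * v) + v) * ((\<epsilon>\<^sup>2 + \<epsilon>) * x)"
              using C v \<epsilon> by (simp_all add: x_def)
            thus ?thesis unfolding C2_def by (simp add: algebra_simps)
          qed
          finally show ?thesis by (simp only: x_def y_def)
        qed
        moreover have "1 - (prob E1 + prob E2) \<le> prob {\<omega> \<in> space M. cond_number n (circulant n (\<lambda>k. \<xi> k \<omega>))
            \<le> ereal (5 * (sqrt (real n) * ln (real n)) / (\<epsilon> * real n powr (-\<rho>)))}"
          using n \<epsilon> by (intro prob_cond_number_ge E1 E2) auto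
        ultimately show ?case unfolding quotient[OF n] by linarith
      qed
    qed
  qed
qed

end
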